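(* Suppose that $0<\alpha<\frac12$ and $k\le c\min\{p^{\gamma},\frac{n}{\log p}\}$ for some constants $c>0$ and $0\le\gamma<\frac12$. Let $q=c_q\,p^{\gamma_q}$ with a constant $c_q>0$ and $2\gamma<\gamma_q\le1$ (the dense loading regime), and let $k_1\le(1-\zeta_0)k-1$ for some constant $0<\zeta_0<1$. Then for any $\theta^*=(\beta^*,\mathrm{I},\sigma)\in\Theta(k_1)$ and $\xi\in\Xi(q,\bar c)$, there is some constant $c_1>0$ such that $$\inf_{\mathrm{CI}\in\mathcal{I}_\alpha(\Theta(k),\,\xi^{\intercal}\beta)}\mathbb{E}_{\theta^*}L(\mathrm{CI})\ge c_1\,\|\xi\|_\infty\,k\sqrt{\frac{\log p}{n}}\;\sigma.$$
   Context: Model: one observes $Z=(Z_1,\dots,Z_n)$ with $Z_i=(y_i,X_{i\cdot})\in\mathbb{R}^{p+1}$, $y=X\beta+\epsilon$, where $X\in\mathbb{R}^{n\times p}$ has i.i.d. rows $X_{i\cdot}\sim N_p(0,\Sigma)$, independent of $\epsilon\sim N_n(0,\sigma^2\mathrm{I})$; $\Sigma$ and $\sigma$ are unknown. Let $\Omega=\Sigma^{-1}$ and $\theta=(\beta,\Omega,\sigma)$; $\mathbb{P}_\theta,\mathbb{E}_\theta$ are the corresponding probability and expectation. $\mathrm{I}$ is the identity matrix. $\|x\|_0$ is the number of nonzero entries of $x$, $\mathrm{supp}(x)$ the set of their indices, $\|x\|_\infty=\max_j|x_j|$. Parameter space: $\Theta(k)=\{(\beta,\Omega,\sigma):\|\beta\|_0\le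 k,\ \frac1{M_1}\le\lambda_{\min}(\Omega)\le\lambda_{\max}(\Omega)\le M_1,\ 0<\sigma\le M_2\}$, where $M_1>1$ and $M_2>0$ are constants. Loadings: $\Xi(q,\bar c)=\{\xi\in\mathbb{R}^p:\ \|\xi\|_0=q,\ \xi\ne 0,\ \max_{j\in\mathrm{supp}(\xi)}|\xi_j|\,/\min_{j\in\mathrm{supp}(\xi)}|\xi_j|\le\bar c\}$, where $\bar c\ge1$ is a constant. Confidence intervals: for a parameter space $\Theta$ and functional $\mathrm{T}$ of $\beta$, $\mathcal{I}_\alpha(\Theta,\mathrm{T})$ is the set of all intervals $\mathrm{CI}=[l(Z),u(Z)]$ with $\inf_{\theta\in\Theta}\mathbb{P}_\theta(l(Z)\le\mathrm{T}(\beta)\le u(Z))\ge1-\alpha$; the length is $L(\mathrm{CI})=u(Z)-l(Z)$. *)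

theory Defs
  imports "HOL-Probability.Probability" "Jordan_Normal_Form.Char_Poly"
begin

text \<open>Vectors and matrices are those of \<open>Jordan_Normal_Form\<close>, whose dimensions are ordinary
  natural numbers, so that one constant can be claimed for all \<open>n\<close> and \<open>p\<close> simultaneously.
  A parameter is a triple \<open>\<theta> = (\<beta>, \<Omega>, \<sigma>)\<close>.\<close>

type_synonym param = "real vec \<times> real mat \<times> real"

text \<open>An observation \<open>(y\<^sub>i, X\<^sub>i)\<close>; the second component is a function on \<open>{..<p}\<close>
  (extensional, as an element of a product space). A data set is indexed by \<open>{..<n}\<close>.\<close>

type_synonym obs = "real \<times> (nat \<Rightarrow> real)"
type_synonym data = "nat \<Rightarrow> obs"

definition supp :: "real vec \<Rightarrow> nat set" where
  "supp x = {j. j < dim_vec x \<and> vec_index x j \<noteq> 0}"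

definition l0_norm :: "real vec \<Rightarrow> nat" where
  "l0_norm x = card (supp x)"

text \<open>Only meaningful for \<open>dim_vec x > 0\<close>, because of \<open>Max\<close>.\<close>

definition linf_norm :: "real vec \<Rightarrow> real" where
  "linf_norm x = Max ((\<lambda>j. \<bar>vec_index x j\<bar>) ` {..<dim_vec x})"

text \<open>Extreme eigenvalues, for symmetric real matrices of positive dimension (so that the set of
  real eigenvalues is finite and nonempty).\<close>

definition lambda_min :: "real mat \<Rightarrow> real" where
  "lambda_min A = Min {e. eigenvalue A e}"

definition lambda_max :: "real mat \<Rightarrow> real" where
  "lambda_max A = Max {e. eigenvalue A e}"

text \<open>Symmetry of \<open>\<Omega>\<close> is part of its being the inverse of a covariance matrix.\<close>

definition Theta :: "nat \<Rightarrow> real \<Rightarrow> real \<Rightarrow> nat \<Rightarrow> param set" where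
  "Theta p M1 M2 k = {(\<beta>, \<Omega>, \<sigma>).
     \<beta> \<in> carrier_vec p \<and> \<Omega> \<in> carrier_mat p p \<and> transpose_mat \<Omega> = \<Omega> \<and>
     l0_norm \<beta> \<le> k \<and>
     1 / M1 \<le> lambda_min \<Omega> \<and> lambda_min \<Omega> \<le> lambda_max \<Omega> \<and> lambda_max \<Omega> \<le> M1 \<and>
     0 < \<sigma> \<and> \<sigma> \<le> M2}"

definition Xi :: "nat \<Rightarrow> nat \<Rightarrow> real \<Rightarrow> real vec set" where
  "Xi p q cbar = {\<xi> \<in> carrier_vec p. l0_norm \<xi> = q \<and> \<xi> \<noteq> 0\<^sub>v p \<and>
     Max ((\<lambda>j. \<bar>vec_index \<xi> j\<bar>) ` supp \<xi>) / Min ((\<lambda>j. \<bar>vec_index \<xi> j\<bar>) ` supp \<xi>) \<le> cbar}"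

text \<open>The law \<open>N\<^sub>p(0, \<Sigma>)\<close> with \<open>\<Sigma> = \<Omega>\<^sup>-\<^sup>1\<close>, through its density; \<open>\<Omega>\<close> positive definite.\<close>

definition mvn :: "nat \<Rightarrow> real mat \<Rightarrow> (nat \<Rightarrow> real) measure" where
  "mvn p \<Omega> = density (\<Pi>\<^sub>M j\<in>{..<p}. lborel)
     (\<lambda>x. ennreal (sqrt (Determinant.det \<Omega> / (2 * pi) ^ p) *
        exp (- (scalar_prod (vec p x) (\<Omega> *\<^sub>v vec p x)) / 2)))"

definition obs_space :: "nat \<Rightarrow> obs measure" where
  "obs_space p = borel \<Otimes>\<^sub>M (\<Pi>\<^sub>M j\<in>{..<p}. borel)"

definition data_space :: "nat \<Rightarrow> nat \<Rightarrow> data measure" where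
  "data_space n p = (\<Pi>\<^sub>M i\<in>{..<n}. obs_space p)"

text \<open>The law of one row \<open>(y\<^sub>i, X\<^sub>i)\<close>, where \<open>y\<^sub>i = X\<^sub>i \<beta> + \<epsilon>\<^sub>i\<close> with \<open>X\<^sub>i\<close> and
  \<open>\<epsilon>\<^sub>i\<close> independent.\<close>

definition obs_law :: "nat \<Rightarrow> param \<Rightarrow> obs measure" where
  "obs_law p = (\<lambda>(\<beta>, \<Omega>, \<sigma>).
     distr (mvn p \<Omega> \<Otimes>\<^sub>M density lborel (normal_density 0 \<sigma>)) (obs_space p)
       (\<lambda>(x, e). (scalar_prod (vec p x) \<beta> + e, x)))"

definition data_law :: "nat \<Rightarrow> nat \<Rightarrow> param \<Rightarrow> data measure" where
  "data_law n p \<theta> = (\<Pi>\<^sub>M i\<in>{..<n}. obs_law p \<theta>)"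

text \<open>The set \<open>\<I>\<^sub>\<alpha>(\<Theta>, T)\<close>: pairs of measurable endpoints \<open>l \<le> u\<close> with coverage at least
  \<open>1 - \<alpha>\<close> uniformly over \<open>\<Theta>\<close>.\<close>

definition conf_intervals ::
  "nat \<Rightarrow> nat \<Rightarrow> real \<Rightarrow> param set \<Rightarrow> (real vec \<Rightarrow> real) \<Rightarrow> ((data \<Rightarrow> real) \<times> (data \<Rightarrow> real)) set" where
  "conf_intervals n p \<alpha> \<Theta> T = {(l, u).
     l \<in> borel_measurable (data_space n p) \<and> u \<in> borel_measurable (data_space n p) \<and>
     (\<forall>z\<in>space (data_space n p). l z \<le> u z) \<and>
     (INF \<theta>\<in>\<Theta>. measure (data_law n p \<theta>)
        {z \<in> space (data_law n p \<theta>). l z \<le> T (fst \<theta>) \<and> T (fst \<theta>) \<le> u z}) \<ge> 1 - \<alpha>}"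

text \<open>The expected length is taken in \<open>ennreal\<close>, since it may be infinite; no information is lost
  in the coercion because \<open>l \<le> u\<close>.\<close>

definition expected_length ::
  "nat \<Rightarrow> nat \<Rightarrow> param \<Rightarrow> (data \<Rightarrow> real) \<times> (data \<Rightarrow> real) \<Rightarrow> ennreal" where
  "expected_length n p \<theta> = (\<lambda>(l, u). \<integral>\<^sup>+ z. ennreal (u z - l z) \<partial>data_law n p \<theta>)"

end

theory Submission
  imports Defs
begin

text \<open>The bound is a testing argument between \<open>\<theta>\<^sup>* = (\<beta>, I, \<sigma>)\<close> and a mixture of alternatives that keep
  \<open>\<Omega> = I\<close>. An alternative is \<open>(\<beta> + \<delta>, I, \<sigma>')\<close> with \<open>\<sigma>'\<^sup>2 = \<sigma>\<^sup>2 - \<bar>\<delta>\<bar>\<^sup>2\<close>: lowering the noise level by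
  exactly the variance that \<open>\<delta>\<close> explains leaves the marginal law of \<open>y - X\<beta>\<close> unchanged, so the
  alternative differs from \<open>\<theta>\<^sup>*\<close> only through the covariance \<open>\<delta>\<close> of \<open>y - X\<beta>\<close> and \<open>X\<close>. This is where
  the ignorance of \<open>\<sigma>\<close> enters, and \<open>\<sigma>' \<le> \<sigma>\<close> keeps the alternative inside the parameter space.
  For two such alternatives the likelihood ratios \<open>L\<close>, \<open>L'\<close> of the sample satisfy the exact identity
  \<open>E (L * L') = (1 / (1 - \<langle>\<delta>, \<delta>'\<rangle> / \<sigma>\<^sup>2)) ^ n\<close>
  (\<open>nn_integral_data_lik_ratio_product\<close>). Its proof follows one joint density through the
  integration over the coordinates of a row: \<open>\<phi>(y - X\<delta>) \<phi>(y - X\<delta>')\<close> is a bivariate normal density at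
  \<open>(y, y)\<close>, and integrating out one standard normal coordinate only changes its three covariance
  parameters (\<open>binormal_convolve\<close>).

  For the mixture, \<open>s\<close> disjoint blocks of equal size \<open>m\<close> are cut out of the support of \<open>\<xi>\<close>, where \<open>s\<close>
  is proportional to \<open>k\<close>, and one index is chosen from each block, independently and uniformly;
  \<open>\<delta>\<close> has entries \<open>\<rho> sgn(\<xi>\<^sub>j)\<close> at the chosen indices, with \<open>\<rho>\<close> of order
  \<open>\<sigma> \<surd>(ln p / n)\<close>. The signs make the functional \<open>\<xi>\<^sup>T\<beta>\<close> grow by \<open>\<rho>\<close> times the sum of \<open>s\<close> entries
  \<open>\<bar>\<xi>\<^sub>j\<bar>\<close>, which is of the claimed order because these entries are comparable with the largest one.
  Two independent choices agree in each block with probability \<open>1/m\<close>, independently over the blocks, so that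
  the second moment of the mixed likelihood ratio is at most
  \<open>exp (s (p\<^sup>a - 1) / m)\<close>, with an exponent \<open>a\<close> that is proportional to the square of the constant in
  \<open>\<rho>\<close> (\<open>agreement_sum\<close>). Since \<open>s / m\<close> is at most of order
  \<open>k\<^sup>2 / q\<close>, hence of order \<open>p\<close> to the negative power \<open>2\<gamma> - \<gamma>\<^sub>q\<close>, a small \<open>a\<close> makes
  this as close to one as needed, for all \<open>p\<close> at once.
  The upper end of a confidence interval then exceeds \<open>\<xi>\<^sup>T\<beta>\<close> by the gap
  almost as often under \<open>\<theta>\<^sup>*\<close> as under the mixture (\<open>chi_square_mixture_bound\<close>), while its lower end
  is mostly below \<open>\<xi>\<^sup>T\<beta>\<close>; because \<open>\<alpha> < 1/2\<close> both happen together with positive probability, and then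
  the interval is at least as long as the gap (\<open>expected_length_ge\<close>).\<close>

section \<open>Integrals of normal densities\<close>

lemma nn_integral_cmult_real:
  fixes f :: "'a \<Rightarrow> real"
  assumes "0 \<le> c" "f \<in> borel_measurable M"
  shows "(\<integral>\<^sup>+x. ennreal (c * f x) \<partial>M) = ennreal c * (\<integral>\<^sup>+x. ennreal (f x) \<partial>M)"
  using assms by (simp add: ennreal_mult' nn_integral_cmult)

lemma nn_integral_exp_quadratic:
  fixes P L R :: real
  assumes "P > 0"
  shows "(\<integral>\<^sup>+x. ennreal (exp (- (P * x\<^sup>2 - 2 * L * x + R) / 2)) \<partial>lborel)
       = ennreal (sqrt (2 * pi / P) * exp ((L\<^sup>2 / P - R) / 2))"
proof -
  have dens: "exp (- (P * x\<^sup>2 - 2 * L * x + R) / 2)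
      = sqrt (2 * pi / P) * exp ((L\<^sup>2 / P - R) / 2) * normal_density (L / P) (1 / sqrt P) x" for x
  proof -
    have "- (P * x\<^sup>2 - 2 * L * x + R) / 2
        = (L\<^sup>2 / P - R) / 2 + - (x - L / P)\<^sup>2 / (2 * (1 / sqrt P)\<^sup>2)"
      using assms by (simp add: field_simps power2_eq_square)
    then have "exp (- (P * x\<^sup>2 - 2 * L * x + R) / 2)
        = exp ((L\<^sup>2 / P - R) / 2) * exp (- (x - L / P)\<^sup>2 / (2 * (1 / sqrt P)\<^sup>2))"
      by (simp only: exp_add)
    moreover have "sqrt (2 * pi / P) * (1 / sqrt (2 * pi * (1 / sqrt P)\<^sup>2)) = 1"
      using assms by (simp add: power_divide real_sqrt_mult real_sqrt_divide)
    moreover have "a * u * (b * v) = (a * b) * (u * v)" for a b u v :: real by simp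
    ultimately show ?thesis
      unfolding normal_density_def by simp
  qed
  have "(\<integral>\<^sup>+x. ennreal (normal_density (L / P) (1 / sqrt P) x) \<partial>lborel) = 1"
    using assms by (subst nn_integral_eq_integral) auto
  then show ?thesis
    unfolding dens using assms by (subst nn_integral_cmult_real) auto
qed

text \<open>The density at \<open>(a, b)\<close> of the centred bivariate normal law with variances \<open>v\<close>, \<open>w\<close> and
  covariance \<open>t\<close>.\<close>

definition binormal :: "real \<Rightarrow> real \<Rightarrow> real \<Rightarrow> real \<Rightarrow> real \<Rightarrow> real" where
  "binormal v w t a b = exp (- ((w * a\<^sup>2 - 2 * t * a * b + v * b\<^sup>2) / (v * w - t\<^sup>2)) / 2)
     / (2 * pi * sqrt (v * w - t\<^sup>2))"

lemma binormal_nonneg: "0 \<le> v * w - t\<^sup>2 \<Longrightarrow> 0 \<le> binormal v w t a b"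
  by (simp add: binormal_def)

lemma binormal_measurable [measurable]:
  "f \<in> borel_measurable M \<Longrightarrow> g \<in> borel_measurable M \<Longrightarrow> (\<lambda>x. binormal v w t (f x) (g x)) \<in> borel_measurable M"
  unfolding binormal_def by simp

lemma binormal_diag:
  assumes "s > 0" "s' > 0"
  shows "normal_density 0 s a * normal_density 0 s' b = binormal (s\<^sup>2) (s'\<^sup>2) 0 a b"
proof -
  have "sqrt (2 * pi * s\<^sup>2) * sqrt (2 * pi * s'\<^sup>2) = 2 * pi * sqrt (s\<^sup>2 * s'\<^sup>2)"
    using assms by (simp flip: real_sqrt_mult) (simp add: real_sqrt_mult)
  moreover have "- a\<^sup>2 / (2 * s\<^sup>2) + - b\<^sup>2 / (2 * s'\<^sup>2) = - ((s'\<^sup>2 * a\<^sup>2 + s\<^sup>2 * b\<^sup>2) / (s\<^sup>2 * s'\<^sup>2)) / 2"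
    using assms by (simp add: field_simps)
  ultimately show ?thesis
    unfolding normal_density_def binormal_def by (simp flip: exp_add)
qed

text \<open>Adding the rank-one matrix of \<open>(d, e)\<close> to a positive definite \<open>2 \<times> 2\<close> matrix does not decrease the
  determinant; this keeps the covariance matrix nondegenerate while coordinates are integrated out.\<close>

lemma binormal_det_add:
  fixes v w t d e :: real
  assumes "v > 0" "v * w - t\<^sup>2 > 0"
  shows "v * w - t\<^sup>2 \<le> (v + d\<^sup>2) * (w + e\<^sup>2) - (t + d * e)\<^sup>2"
proof -
  have "0 \<le> (v * e - t * d)\<^sup>2 + (v * w - t\<^sup>2) * d\<^sup>2"
    using assms by simp
  also have "\<dots> = v * (w * d\<^sup>2 - 2 * t * d * e + v * e\<^sup>2)"
    by (simp add: power2_eq_square algebra_simps)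
  finally have "0 \<le> w * d\<^sup>2 - 2 * t * d * e + v * e\<^sup>2"
    using assms(1) by (simp add: zero_le_mult_iff)
  then show ?thesis by (simp add: power2_eq_square algebra_simps)
qed

text \<open>If \<open>(A, B)\<close> has the density \<open>binormal v w t\<close> and \<open>x\<close> is an independent standard normal variable, then
  \<open>(A + xd, B + xe)\<close> is again normal, with covariance matrix increased by that of \<open>x (d, e)\<close>. The integral
  is computed by completing the square. One formula covers coordinates that occur in both of two
  sparse directions, in one of them, or in none.\<close>

lemma binormal_convolve:
  assumes "v > 0" and D: "v * w - t\<^sup>2 > 0"
  shows "(\<integral>\<^sup>+x. ennreal (normal_density 0 1 x * binormal v w t (a - x * d) (b - x * e)) \<partial>lborel)
       = ennreal (binormal (v + d\<^sup>2) (w + e\<^sup>2) (t + d * e) a b)"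
proof -
  define D D' where "D = v * w - t\<^sup>2" and "D' = (v + d\<^sup>2) * (w + e\<^sup>2) - (t + d * e)\<^sup>2"
  have pos: "D > 0" "D' > 0" using binormal_det_add[OF assms, of d e] D by (auto simp: D_def D'_def)
  define L Q Q' where "L = w * a * d - t * (a * e + b * d) + v * b * e"
    and "Q = w * a\<^sup>2 - 2 * t * a * b + v * b\<^sup>2"
    and "Q' = (w + e\<^sup>2) * a\<^sup>2 - 2 * (t + d * e) * a * b + (v + d\<^sup>2) * b\<^sup>2"
  have quad: "w * (a - x * d)\<^sup>2 - 2 * t * (a - x * d) * (b - x * e) + v * (b - x * e)\<^sup>2
      = x\<^sup>2 * (D' - D) - 2 * L * x + Q" for x
    unfolding D_def D'_def L_def Q_def by (simp add: power2_eq_square algebra_simps)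
  \<comment> \<open>The only nontrivial identity: it turns the completed square into the new quadratic form.\<close>
  have key: "L\<^sup>2 - D' * Q = - (D * Q')"
    unfolding D_def D'_def L_def Q_def Q'_def by (simp add: power2_eq_square algebra_simps)
  have integrand: "normal_density 0 1 x * binormal v w t (a - x * d) (b - x * e)
      = 1 / (2 * pi * sqrt (2 * pi) * sqrt D)
        * exp (- (D' / D * x\<^sup>2 - 2 * (L / D) * x + Q / D) / 2)" for x
  proof -
    have "- x\<^sup>2 / 2 + - ((x\<^sup>2 * (D' - D) - 2 * L * x + Q) / D) / 2
        = - (D' / D * x\<^sup>2 - 2 * (L / D) * x + Q / D) / 2"
      using pos by (simp add: field_simps)
    then have "exp (- x\<^sup>2 / 2) * exp (- ((x\<^sup>2 * (D' - D) - 2 * L * x + Q) / D) / 2)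
        = exp (- (D' / D * x\<^sup>2 - 2 * (L / D) * x + Q / D) / 2)"
      by (simp only: exp_add[symmetric])
    then show ?thesis
      unfolding binormal_def quad D_def[symmetric] std_normal_density_def
      by (simp add: field_simps)
  qed
  have exponent: "(L / D)\<^sup>2 / (D' / D) - Q / D = - (Q' / D')"
  proof -
    have "(L / D)\<^sup>2 / (D' / D) - Q / D = (L\<^sup>2 - D' * Q) / (D * D')"
      using pos by (simp add: field_simps power2_eq_square)
    also have "\<dots> = - (Q' / D')" unfolding key using pos by simp
    finally show ?thesis .
  qed
  have const: "1 / (2 * pi * sqrt (2 * pi) * sqrt D) * sqrt (2 * pi / (D' / D)) = 1 / (2 * pi * sqrt D')"
    using pos by (simp add: real_sqrt_mult real_sqrt_divide)
  have "(\<integral>\<^sup>+x. ennreal (normal_density 0 1 x * binormal v w t (a - x * d) (b - x * e)) \<partial>lborel)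
      = ennreal (1 / (2 * pi * sqrt (2 * pi) * sqrt D)) *
        (\<integral>\<^sup>+x. ennreal (exp (- (D' / D * x\<^sup>2 - 2 * (L / D) * x + Q / D) / 2)) \<partial>lborel)"
    unfolding integrand using pos by (intro nn_integral_cmult_real) auto
  also have "\<dots> = ennreal (1 / (2 * pi * sqrt (2 * pi) * sqrt D) * sqrt (2 * pi / (D' / D))
        * exp (- (Q' / D') / 2))"
    unfolding nn_integral_exp_quadratic[OF divide_pos_pos[OF pos(2,1)], of "L / D" "Q / D"] exponent
    using pos by (simp add: mult.assoc flip: ennreal_mult')
  also have "\<dots> = ennreal (binormal (v + d\<^sup>2) (w + e\<^sup>2) (t + d * e) a b)"
    unfolding const by (simp add: binormal_def D'_def Q'_def)
  finally show ?thesis .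
qed

interpretation lborel_product: product_sigma_finite "\<lambda>_::nat. lborel :: real measure" ..

lemma binormal_convolve_product:
  fixes J :: "nat set" and d e :: "nat \<Rightarrow> real"
  assumes "finite J" "v > 0" "v * w - t\<^sup>2 > 0"
  shows "(\<integral>\<^sup>+x. ennreal ((\<Prod>j\<in>J. normal_density 0 1 (x j))
            * binormal v w t (a - (\<Sum>j\<in>J. x j * d j)) (b - (\<Sum>j\<in>J. x j * e j)))
          \<partial>(\<Pi>\<^sub>M j\<in>J. lborel))
       = ennreal (binormal (v + (\<Sum>j\<in>J. (d j)\<^sup>2)) (w + (\<Sum>j\<in>J. (e j)\<^sup>2))
                    (t + (\<Sum>j\<in>J. d j * e j)) a b)"
  using assms
proof (induction J arbitrary: v w t rule: finite_induct)
  case empty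
  then show ?case by (subst lborel_product.nn_integral_empty) simp_all
next
  case (insert i J)
  have D': "(v + (d i)\<^sup>2) * (w + (e i)\<^sup>2) - (t + d i * e i)\<^sup>2 > 0"
    using binormal_det_add[OF insert.prems, of "d i" "e i"] insert.prems by linarith
  have "(\<integral>\<^sup>+x. ennreal ((\<Prod>j\<in>insert i J. normal_density 0 1 (x j))
            * binormal v w t (a - (\<Sum>j\<in>insert i J. x j * d j)) (b - (\<Sum>j\<in>insert i J. x j * e j)))
          \<partial>(\<Pi>\<^sub>M j\<in>insert i J. lborel))
     = (\<integral>\<^sup>+x. \<integral>\<^sup>+y. ennreal ((\<Prod>j\<in>insert i J. normal_density 0 1 ((x(i := y)) j))
            * binormal v w t (a - (\<Sum>j\<in>insert i J. (x(i := y)) j * d j))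
                             (b - (\<Sum>j\<in>insert i J. (x(i := y)) j * e j))) \<partial>lborel
          \<partial>(\<Pi>\<^sub>M j\<in>J. lborel))"
    using insert.hyps by (subst lborel_product.product_nn_integral_insert) auto
  also have "\<dots> = (\<integral>\<^sup>+x. ennreal (\<Prod>j\<in>J. normal_density 0 1 (x j)) *
          (\<integral>\<^sup>+y. ennreal (normal_density 0 1 y *
            binormal v w t ((a - (\<Sum>j\<in>J. x j * d j)) - y * d i)
                           ((b - (\<Sum>j\<in>J. x j * e j)) - y * e i)) \<partial>lborel)
          \<partial>(\<Pi>\<^sub>M j\<in>J. lborel))"
  proof (intro nn_integral_cong)
    fix x :: "nat \<Rightarrow> real"
    have upd: "(\<Sum>j\<in>insert i J. (x(i := y)) j * f j) = y * f i + (\<Sum>j\<in>J. x j * f j)"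
      for y and f :: "nat \<Rightarrow> real"
      using insert.hyps by (auto intro!: sum.cong)
    have updp: "(\<Prod>j\<in>insert i J. normal_density 0 1 ((x(i := y)) j))
        = normal_density 0 1 y * (\<Prod>j\<in>J. normal_density 0 1 (x j))" for y
      using insert.hyps by (auto intro!: prod.cong)
    show "(\<integral>\<^sup>+y. ennreal ((\<Prod>j\<in>insert i J. normal_density 0 1 ((x(i := y)) j))
            * binormal v w t (a - (\<Sum>j\<in>insert i J. (x(i := y)) j * d j))
                             (b - (\<Sum>j\<in>insert i J. (x(i := y)) j * e j))) \<partial>lborel)
        = ennreal (\<Prod>j\<in>J. normal_density 0 1 (x j)) *
          (\<integral>\<^sup>+y. ennreal (normal_density 0 1 y *
            binormal v w t ((a - (\<Sum>j\<in>J. x j * d j)) - y * d i)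
                           ((b - (\<Sum>j\<in>J. x j * e j)) - y * e i)) \<partial>lborel)"
      unfolding upd updp
      by (subst nn_integral_cmult[symmetric])
        (auto simp: prod_nonneg ennreal_mult'[symmetric] algebra_simps intro!: nn_integral_cong)
  qed
  also have "\<dots> = (\<integral>\<^sup>+x. ennreal ((\<Prod>j\<in>J. normal_density 0 1 (x j))
      * binormal (v + (d i)\<^sup>2) (w + (e i)\<^sup>2) (t + d i * e i)
           (a - (\<Sum>j\<in>J. x j * d j)) (b - (\<Sum>j\<in>J. x j * e j))) \<partial>(\<Pi>\<^sub>M j\<in>J. lborel))"
    unfolding binormal_convolve[OF insert.prems] by (simp add: prod_nonneg ennreal_mult')
  also have "\<dots> = ennreal (binormal (v + (d i)\<^sup>2 + (\<Sum>j\<in>J. (d j)\<^sup>2)) (w + (e i)\<^sup>2 + (\<Sum>j\<in>J. (e j)\<^sup>2))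
                    (t + d i * e i + (\<Sum>j\<in>J. d j * e j)) a b)"
    using insert.prems D' by (intro insert.IH) (auto intro: add_pos_nonneg)
  finally show ?case using insert.hyps by (simp add: add.assoc)
qed

text \<open>The last step of the second-moment computation: \<open>y\<close> has variance \<open>\<sigma>\<^sup>2\<close> under both alternatives, and
  their overlap \<open>t\<close> is all that remains.\<close>

lemma binormal_over_normal:
  assumes "\<sigma> > 0" "\<bar>t\<bar> < \<sigma>\<^sup>2"
  shows "(\<integral>\<^sup>+y. ennreal (binormal (\<sigma>\<^sup>2) (\<sigma>\<^sup>2) t y y / normal_density 0 \<sigma> y) \<partial>lborel)
       = ennreal (\<sigma>\<^sup>2 / (\<sigma>\<^sup>2 - t))"
proof -
  define S where "S = \<sigma>\<^sup>2"
  have pos: "S > 0" "S - t > 0" "S + t > 0" using assms by (auto simp: S_def)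
  \<comment> \<open>With \<open>S = \<sigma>\<^sup>2\<close>, the exponents \<open>- y\<^sup>2 / (S + t)\<close> and \<open>y\<^sup>2 / (2 * S)\<close> combine to \<open>- P * y\<^sup>2 / 2\<close>.\<close>
  define P where "P = (S - t) / (S * (S + t))"
  have P: "P > 0" using pos by (simp add: P_def)
  have D: "S * S - t\<^sup>2 = (S - t) * (S + t)" by (simp add: power2_eq_square algebra_simps)
  define K where "K = sqrt (2 * pi * S) / (2 * pi * sqrt ((S - t) * (S + t)))"
  have "K \<ge> 0" using pos by (simp add: K_def)
  have "binormal S S t y y / normal_density 0 \<sigma> y
      = K * exp (- (P * y\<^sup>2 - 2 * 0 * y + 0) / 2)" for y
  proof -
    have "(S * y\<^sup>2 - 2 * t * y * y + S * y\<^sup>2) / ((S - t) * (S + t)) = (2 * y\<^sup>2 * (S - t)) / ((S + t) * (S - t))"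
      by (simp add: power2_eq_square algebra_simps)
    also have "\<dots> = 2 * y\<^sup>2 / (S + t)" using pos by simp
    finally have *: "(S * y\<^sup>2 - 2 * t * y * y + S * y\<^sup>2) / ((S - t) * (S + t)) = 2 * y\<^sup>2 / (S + t)" .
    have "- (2 * y\<^sup>2 / (S + t)) / 2 - (- y\<^sup>2 / (2 * S)) = - (P * y\<^sup>2) / 2"
      unfolding P_def using pos by (simp add: divide_simps) (simp add: algebra_simps)
    then have "exp (- (2 * y\<^sup>2 / (S + t)) / 2) / exp (- y\<^sup>2 / (2 * S)) = exp (- (P * y\<^sup>2) / 2)"
      by (simp only: exp_diff[symmetric])
    then show ?thesis
      unfolding binormal_def D * normal_density_def S_def[symmetric] K_def
      by (simp add: divide_simps)
  qed
  then have "(\<integral>\<^sup>+y. ennreal (binormal S S t y y / normal_density 0 \<sigma> y) \<partial>lborel)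
     = ennreal (K * sqrt (2 * pi / P))"
    using \<open>K \<ge> 0\<close> nn_integral_exp_quadratic[OF P, of 0 0]
    by (simp add: ennreal_mult' nn_integral_cmult)
  also have "K * sqrt (2 * pi / P) = S / (S - t)"
  proof -
    define A where "A = 2 * pi * S"
    have A: "A > 0" "2 * pi / P = A * ((S + t) / (S - t))" using pos by (simp_all add: A_def P_def)
    have "K * sqrt (2 * pi / P) = sqrt A * sqrt A / (2 * pi * (sqrt (S - t) * sqrt (S - t)))"
      unfolding K_def A(2) A_def[symmetric] using pos by (simp add: real_sqrt_mult real_sqrt_divide)
    also have "\<dots> = S / (S - t)" using pos A(1) by (simp add: A_def)
    finally show ?thesis .
  qed
  finally show ?thesis by (simp add: S_def)
qed


section \<open>Likelihood ratios for identity covariance\<close>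

lemma mvn_identity:
  "mvn p (1\<^sub>m p) = density (\<Pi>\<^sub>M j\<in>{..<p}. lborel)
     (\<lambda>x. ennreal (\<Prod>j<p. normal_density 0 1 (x j)))"
proof -
  have "sqrt (Determinant.det (1\<^sub>m p) / (2 * pi) ^ p) *
        exp (- (scalar_prod (Matrix.vec p x) (1\<^sub>m p *\<^sub>v Matrix.vec p x)) / 2)
      = (\<Prod>j<p. normal_density 0 1 (x j))" for x :: "nat \<Rightarrow> real"
  proof -
    have "scalar_prod (Matrix.vec p x) (1\<^sub>m p *\<^sub>v Matrix.vec p x) = (\<Sum>j<p. (x j)\<^sup>2)"
      by (simp add: scalar_prod_def power2_eq_square atLeast0LessThan)
    moreover have "sqrt (1 / (2 * pi) ^ p) = (\<Prod>j<p. 1 / sqrt (2 * pi))"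
      by (simp add: real_sqrt_divide power_one_over real_sqrt_power[symmetric])
    moreover have "exp (- (\<Sum>j<p. (x j)\<^sup>2) / 2) = (\<Prod>j<p. exp (- (x j)\<^sup>2 / 2))"
      by (simp add: exp_sum[symmetric] sum_negf sum_divide_distrib)
    ultimately show ?thesis
      unfolding std_normal_density_def by (simp add: prod.distrib prod_dividef power_divide)
  qed
  then show ?thesis by (simp add: mvn_def)
qed

text \<open>The density of the response given the covariates; the covariates keep the same law for all
  parameters with \<open>\<Omega> = I\<close>, so that likelihood ratios are quotients of these densities.\<close>

definition cond_density :: "nat \<Rightarrow> real Matrix.vec \<Rightarrow> real \<Rightarrow> obs \<Rightarrow> real" where
  "cond_density p \<beta> \<sigma> z = normal_density 0 \<sigma> (fst z - (\<Sum>j<p. snd z j * vec_index \<beta> j))"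

lemma cond_density_measurable [measurable]:
  "cond_density p \<beta> \<sigma> \<in> borel_measurable (obs_space p)"
  unfolding cond_density_def obs_space_def by measurable

lemma cond_density_pos: "\<sigma> > 0 \<Longrightarrow> cond_density p \<beta> \<sigma> z > 0"
  by (simp add: cond_density_def normal_density_pos)

lemma sets_obs_law [simp, measurable_cong]: "sets (obs_law p \<theta>) = sets (obs_space p)"
  by (cases \<theta>) (simp add: obs_law_def)

lemma nn_integral_obs_law:
  assumes "\<beta> \<in> carrier_vec p" and h [measurable]: "h \<in> borel_measurable (obs_space p)" and "\<sigma> > 0"
  shows "(\<integral>\<^sup>+z. h z \<partial>obs_law p (\<beta>, 1\<^sub>m p, \<sigma>))
    = (\<integral>\<^sup>+x. ennreal (\<Prod>j<p. normal_density 0 1 (x j)) *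
        (\<integral>\<^sup>+y. ennreal (cond_density p \<beta> \<sigma> (y, x)) * h (y, x) \<partial>lborel) \<partial>(\<Pi>\<^sub>M j\<in>{..<p}. lborel))"
proof -
  let ?N = "\<Pi>\<^sub>M j\<in>{..<p}. (lborel :: real measure)"
  let ?E = "density lborel (normal_density 0 \<sigma>)"
  define lin where "lin x = (\<Sum>j<p. x j * vec_index \<beta> j)" for x :: "nat \<Rightarrow> real"
  have lin [measurable]: "lin \<in> borel_measurable ?N"
    unfolding lin_def by measurable
  have h' [measurable]: "h \<in> borel_measurable (borel \<Otimes>\<^sub>M (\<Pi>\<^sub>M j\<in>{..<p}. borel))"
    using h by (simp add: obs_space_def)
  interpret E: prob_space ?E using assms(3) by (rule prob_space_normal_density)
  have sp: "scalar_prod (Matrix.vec p x) \<beta> = lin x" for x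
    using assms(1) by (simp add: scalar_prod_def lin_def atLeast0LessThan)
  have map [measurable]: "(\<lambda>(x, e). (scalar_prod (Matrix.vec p x) \<beta> + e, x))
      \<in> measurable (mvn p (1\<^sub>m p) \<Otimes>\<^sub>M ?E) (obs_space p)"
    unfolding sp mvn_identity obs_space_def by measurable
  have "(\<integral>\<^sup>+z. h z \<partial>obs_law p (\<beta>, 1\<^sub>m p, \<sigma>))
      = (\<integral>\<^sup>+q. h (case q of (x, e) \<Rightarrow> (scalar_prod (Matrix.vec p x) \<beta> + e, x)) \<partial>(mvn p (1\<^sub>m p) \<Otimes>\<^sub>M ?E))"
    unfolding obs_law_def prod.case by (subst nn_integral_distr) (auto simp: case_prod_unfold)
  also have "\<dots> = (\<integral>\<^sup>+x. \<integral>\<^sup>+e. h (lin x + e, x) \<partial>?E \<partial>mvn p (1\<^sub>m p))"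
    by (subst E.nn_integral_fst[symmetric]) (auto simp: sp mvn_identity)
  also have "\<dots> = (\<integral>\<^sup>+x. ennreal (\<Prod>j<p. normal_density 0 1 (x j)) *
      (\<integral>\<^sup>+e. h (lin x + e, x) \<partial>?E) \<partial>?N)"
    unfolding mvn_identity by (subst nn_integral_density) auto
  also have "\<dots> = (\<integral>\<^sup>+x. ennreal (\<Prod>j<p. normal_density 0 1 (x j)) *
        (\<integral>\<^sup>+y. ennreal (cond_density p \<beta> \<sigma> (y, x)) * h (y, x) \<partial>lborel) \<partial>?N)"
  proof (intro nn_integral_cong arg_cong2[where f = "(*)"] refl)
    fix x assume [measurable]: "x \<in> space ?N"
    have "x \<in> space (\<Pi>\<^sub>M j\<in>{..<p}. (borel :: real measure))"
      using \<open>x \<in> space ?N\<close> by (simp add: space_PiM)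
    note this [measurable]
    have "(\<integral>\<^sup>+y. ennreal (cond_density p \<beta> \<sigma> (y, x)) * h (y, x) \<partial>lborel)
        = (\<integral>\<^sup>+e. ennreal (cond_density p \<beta> \<sigma> (lin x + 1 * e, x)) * h (lin x + 1 * e, x) \<partial>lborel)"
      unfolding cond_density_def fst_conv snd_conv
      by (subst nn_integral_real_affine[where c = 1 and t = "lin x"]) auto
    also have "\<dots> = (\<integral>\<^sup>+e. h (lin x + e, x) \<partial>?E)"
      by (subst nn_integral_density) (auto simp: cond_density_def lin_def)
    finally show "(\<integral>\<^sup>+e. h (lin x + e, x) \<partial>?E)
      = (\<integral>\<^sup>+y. ennreal (cond_density p \<beta> \<sigma> (y, x)) * h (y, x) \<partial>lborel)" ..
  qed
  finally show ?thesis .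
qed

lemma prob_space_obs_law:
  assumes "\<beta> \<in> carrier_vec p" "\<sigma> > 0"
  shows "prob_space (obs_law p (\<beta>, 1\<^sub>m p, \<sigma>))"
proof
  have inner: "(\<integral>\<^sup>+y. ennreal (cond_density p \<beta> \<sigma> (y, x)) \<partial>lborel) = 1" for x :: "nat \<Rightarrow> real"
  proof -
    have "cond_density p \<beta> \<sigma> (y, x) = normal_density (\<Sum>j<p. x j * vec_index \<beta> j) \<sigma> y" for y
      by (simp add: cond_density_def normal_density_def)
    then show ?thesis
      using assms(2) by (subst nn_integral_eq_integral) auto
  qed
  have "emeasure (obs_law p (\<beta>, 1\<^sub>m p, \<sigma>)) (space (obs_law p (\<beta>, 1\<^sub>m p, \<sigma>)))
      = (\<integral>\<^sup>+z. 1 \<partial>obs_law p (\<beta>, 1\<^sub>m p, \<sigma>))" by simp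
  also have "\<dots> = (\<integral>\<^sup>+x. (\<Prod>j<p. ennreal (normal_density 0 1 (x j))) \<partial>(\<Pi>\<^sub>M j\<in>{..<p}. lborel))"
    by (subst nn_integral_obs_law) (auto simp: assms inner prod_ennreal)
  also have "\<dots> = (\<Prod>j<p. \<integral>\<^sup>+t. ennreal (normal_density 0 1 t) \<partial>lborel)"
    by (subst lborel_product.product_nn_integral_prod) auto
  also have "\<dots> = 1"
    by (subst nn_integral_eq_integral) auto
  finally show "emeasure (obs_law p (\<beta>, 1\<^sub>m p, \<sigma>)) (space (obs_law p (\<beta>, 1\<^sub>m p, \<sigma>))) = 1" .
qed

lemma obs_law_density:
  assumes "\<beta> \<in> carrier_vec p" "\<beta>' \<in> carrier_vec p" "\<sigma> > 0" "\<sigma>' > 0"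
  shows "obs_law p (\<beta>', 1\<^sub>m p, \<sigma>') = density (obs_law p (\<beta>, 1\<^sub>m p, \<sigma>))
           (\<lambda>z. ennreal (cond_density p \<beta>' \<sigma>' z / cond_density p \<beta> \<sigma> z))"
proof (rule measure_eqI)
  fix A assume "A \<in> sets (obs_law p (\<beta>', 1\<^sub>m p, \<sigma>'))"
  then have A [measurable]: "A \<in> sets (obs_space p)" by simp
  have "emeasure (obs_law p (\<beta>', 1\<^sub>m p, \<sigma>')) A = (\<integral>\<^sup>+z. indicator A z \<partial>obs_law p (\<beta>', 1\<^sub>m p, \<sigma>'))"
    by simp
  also have "\<dots> = (\<integral>\<^sup>+z. ennreal (cond_density p \<beta>' \<sigma>' z / cond_density p \<beta> \<sigma> z) * indicator A z
      \<partial>obs_law p (\<beta>, 1\<^sub>m p, \<sigma>))"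
    using cond_density_pos[OF assms(3)] cond_density_pos[OF assms(4)]
    by (subst (1 2) nn_integral_obs_law)
      (auto simp: assms less_imp_le ennreal_mult'[symmetric] mult.assoc[symmetric] less_imp_neq[symmetric])
  also have "\<dots> = emeasure (density (obs_law p (\<beta>, 1\<^sub>m p, \<sigma>))
           (\<lambda>z. ennreal (cond_density p \<beta>' \<sigma>' z / cond_density p \<beta> \<sigma> z))) A"
    by (subst emeasure_density) auto
  finally show "emeasure (obs_law p (\<beta>', 1\<^sub>m p, \<sigma>')) A = \<dots>" .
qed simp

text \<open>Because the residual \<open>y - X\<beta>\<close> has variance \<open>\<sigma>\<^sup>2\<close> under both alternatives (hypotheses \<open>var\<close>), the second
  moment depends on \<open>\<delta>\<close> and \<open>\<delta>'\<close> through their inner product alone. After the shift by \<open>X\<beta>\<close> and an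
  exchange of the integrals, the covariates are integrated out first, with \<open>y\<close> fixed.\<close>

lemma nn_integral_lik_ratio_product:
  assumes "\<beta> \<in> carrier_vec p" "\<delta> \<in> carrier_vec p" "\<delta>' \<in> carrier_vec p" "\<sigma> > 0" "s > 0" "s' > 0"
    and var: "s\<^sup>2 + (\<Sum>j<p. (vec_index \<delta> j)\<^sup>2) = \<sigma>\<^sup>2" "s'\<^sup>2 + (\<Sum>j<p. (vec_index \<delta>' j)\<^sup>2) = \<sigma>\<^sup>2"
    and cov: "\<bar>\<Sum>j<p. vec_index \<delta> j * vec_index \<delta>' j\<bar> < \<sigma>\<^sup>2"
  shows "(\<integral>\<^sup>+z. ennreal (cond_density p (\<beta> + \<delta>) s z / cond_density p \<beta> \<sigma> z
             * (cond_density p (\<beta> + \<delta>') s' z / cond_density p \<beta> \<sigma> z)) \<partial>obs_law p (\<beta>, 1\<^sub>m p, \<sigma>))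
       = ennreal (\<sigma>\<^sup>2 / (\<sigma>\<^sup>2 - (\<Sum>j<p. vec_index \<delta> j * vec_index \<delta>' j)))"
proof -
  let ?N = "\<Pi>\<^sub>M j\<in>{..<p}. (lborel :: real measure)"
  let ?\<tau> = "\<Sum>j<p. vec_index \<delta> j * vec_index \<delta>' j"
  define lin where "lin d x = (\<Sum>j<p. x j * vec_index d j)" for d and x :: "nat \<Rightarrow> real"
  have lin [measurable]: "lin d \<in> borel_measurable ?N" for d
    unfolding lin_def by measurable
  have lin_add: "(\<Sum>j<p. x j * vec_index (\<beta> + d) j) = lin \<beta> x + lin d x" if "d \<in> carrier_vec p" for d x
    using assms(1) that by (simp add: lin_def sum.distrib[symmetric] ring_distribs)
  define F where "F x y = (\<Prod>j<p. normal_density 0 1 (x j)) *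
      binormal (s\<^sup>2) (s'\<^sup>2) 0 (y - lin \<delta> x) (y - lin \<delta>' x) / normal_density 0 \<sigma> y" for x y
  have [measurable]: "(\<lambda>(x, y). F x y) \<in> borel_measurable (?N \<Otimes>\<^sub>M lborel)"
    unfolding F_def by measurable
  interpret N: sigma_finite_measure ?N by (intro lborel_product.sigma_finite) simp
  interpret NL: pair_sigma_finite ?N "lborel :: real measure" ..
  have pos: "normal_density 0 \<sigma> y > 0" for y using assms by (simp add: normal_density_pos)
  have F_nonneg: "F x y \<ge> 0" for x y
    unfolding F_def using assms by (auto intro!: divide_nonneg_nonneg mult_nonneg_nonneg prod_nonneg binormal_nonneg)
  have "(\<integral>\<^sup>+z. ennreal (cond_density p (\<beta> + \<delta>) s z / cond_density p \<beta> \<sigma> z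
             * (cond_density p (\<beta> + \<delta>') s' z / cond_density p \<beta> \<sigma> z)) \<partial>obs_law p (\<beta>, 1\<^sub>m p, \<sigma>))
      = (\<integral>\<^sup>+x. ennreal (\<Prod>j<p. normal_density 0 1 (x j)) *
          (\<integral>\<^sup>+y. ennreal (cond_density p \<beta> \<sigma> (y, x)) *
             ennreal (cond_density p (\<beta> + \<delta>) s (y, x) / cond_density p \<beta> \<sigma> (y, x)
             * (cond_density p (\<beta> + \<delta>') s' (y, x) / cond_density p \<beta> \<sigma> (y, x))) \<partial>lborel) \<partial>?N)"
    by (rule nn_integral_obs_law) (use assms in measurable)
  also have "\<dots> = (\<integral>\<^sup>+x. \<integral>\<^sup>+y. ennreal (F x y) \<partial>lborel \<partial>?N)"
  proof (intro nn_integral_cong)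
    fix x assume [measurable]: "x \<in> space ?N"
    have "(\<integral>\<^sup>+y. ennreal (cond_density p \<beta> \<sigma> (y, x)) *
             ennreal (cond_density p (\<beta> + \<delta>) s (y, x) / cond_density p \<beta> \<sigma> (y, x)
             * (cond_density p (\<beta> + \<delta>') s' (y, x) / cond_density p \<beta> \<sigma> (y, x))) \<partial>lborel)
        = (\<integral>\<^sup>+y. ennreal (binormal (s\<^sup>2) (s'\<^sup>2) 0 ((y - lin \<beta> x) - lin \<delta> x) ((y - lin \<beta> x) - lin \<delta>' x)
             / normal_density 0 \<sigma> (y - lin \<beta> x)) \<partial>lborel)"
    proof (intro nn_integral_cong)
      fix y
      have ne: "normal_density 0 \<sigma> (y - lin \<beta> x) \<noteq> 0" using pos[of "y - lin \<beta> x"] by simp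
      show "ennreal (cond_density p \<beta> \<sigma> (y, x)) *
             ennreal (cond_density p (\<beta> + \<delta>) s (y, x) / cond_density p \<beta> \<sigma> (y, x)
             * (cond_density p (\<beta> + \<delta>') s' (y, x) / cond_density p \<beta> \<sigma> (y, x)))
          = ennreal (binormal (s\<^sup>2) (s'\<^sup>2) 0 ((y - lin \<beta> x) - lin \<delta> x) ((y - lin \<beta> x) - lin \<delta>' x)
             / normal_density 0 \<sigma> (y - lin \<beta> x))"
        unfolding cond_density_def fst_conv snd_conv lin_add[OF assms(2)] lin_add[OF assms(3)]
          lin_def[of \<beta>, symmetric] binormal_diag[OF assms(5,6), symmetric]
        by (subst ennreal_mult'[symmetric]) (use ne in \<open>simp_all add: diff_diff_eq\<close>)
    qed
    also have "\<dots> = (\<integral>\<^sup>+y. ennreal (binormal (s\<^sup>2) (s'\<^sup>2) 0 (y - lin \<delta> x) (y - lin \<delta>' x)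
             / normal_density 0 \<sigma> y) \<partial>lborel)"
      by (subst nn_integral_real_affine[where c = 1 and t = "lin \<beta> x"]) auto
    finally show "ennreal (\<Prod>j<p. normal_density 0 1 (x j)) *
          (\<integral>\<^sup>+y. ennreal (cond_density p \<beta> \<sigma> (y, x)) *
             ennreal (cond_density p (\<beta> + \<delta>) s (y, x) / cond_density p \<beta> \<sigma> (y, x)
             * (cond_density p (\<beta> + \<delta>') s' (y, x) / cond_density p \<beta> \<sigma> (y, x))) \<partial>lborel)
        = (\<integral>\<^sup>+y. ennreal (F x y) \<partial>lborel)"
      unfolding F_def times_divide_eq_right[symmetric]
      by (subst nn_integral_cmult_real) (auto simp: prod_nonneg)
  qed
  also have "\<dots> = (\<integral>\<^sup>+y. \<integral>\<^sup>+x. ennreal (F x y) \<partial>?N \<partial>lborel)"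
    by (rule NL.Fubini'[symmetric]) measurable
  also have "\<dots> = (\<integral>\<^sup>+y. ennreal (binormal (\<sigma>\<^sup>2) (\<sigma>\<^sup>2) ?\<tau> y y / normal_density 0 \<sigma> y) \<partial>lborel)"
  proof (intro nn_integral_cong)
    fix y :: real
    have "(\<integral>\<^sup>+x. ennreal (F x y) \<partial>?N)
        = (\<integral>\<^sup>+x. ennreal ((1 / normal_density 0 \<sigma> y) * ((\<Prod>j<p. normal_density 0 1 (x j)) *
            binormal (s\<^sup>2) (s'\<^sup>2) 0 (y - (\<Sum>j<p. x j * vec_index \<delta> j)) (y - (\<Sum>j<p. x j * vec_index \<delta>' j)))) \<partial>?N)"
      by (simp add: F_def lin_def)
    also have "\<dots> = ennreal (1 / normal_density 0 \<sigma> y) *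
        ennreal (binormal (s\<^sup>2 + (\<Sum>j<p. (vec_index \<delta> j)\<^sup>2)) (s'\<^sup>2 + (\<Sum>j<p. (vec_index \<delta>' j)\<^sup>2)) (0 + ?\<tau>) y y)"
      using assms by (subst nn_integral_cmult_real) (auto simp: binormal_convolve_product)
    also have "\<dots> = ennreal (binormal (\<sigma>\<^sup>2) (\<sigma>\<^sup>2) ?\<tau> y y / normal_density 0 \<sigma> y)"
      unfolding var by (subst ennreal_mult'[symmetric]) auto
    finally show "(\<integral>\<^sup>+x. ennreal (F x y) \<partial>?N) = \<dots>" .
  qed
  also have "\<dots> = ennreal (\<sigma>\<^sup>2 / (\<sigma>\<^sup>2 - ?\<tau>))"
    using assms by (intro binormal_over_normal) auto
  finally show ?thesis .
qed

lemma PiM_density: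
  assumes "finite I" "prob_space M" "prob_space (density M g)"
    and [measurable]: "g \<in> borel_measurable M"
  shows "(\<Pi>\<^sub>M i\<in>I. density M g) = density (\<Pi>\<^sub>M i\<in>I. M) (\<lambda>z. \<Prod>i\<in>I. g (z i))"
proof -
  interpret M: product_prob_space "\<lambda>_. M" I by (rule product_prob_spaceI) fact
  interpret G: product_prob_space "\<lambda>_. density M g" I by (rule product_prob_spaceI) fact
  show ?thesis
  proof (rule G.PiM_eqI[symmetric, OF assms(1)])
    show "sets (density (\<Pi>\<^sub>M i\<in>I. M) (\<lambda>z. \<Prod>i\<in>I. g (z i))) = sets (\<Pi>\<^sub>M i\<in>I. density M g)"
      by (simp cong: sets_PiM_cong)
    fix A assume "\<And>i. i \<in> I \<Longrightarrow> A i \<in> sets (density M g)"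
    then have A: "\<And>i. i \<in> I \<Longrightarrow> A i \<in> sets M" by simp
    then have [measurable]: "Pi\<^sub>E I A \<in> sets (\<Pi>\<^sub>M i\<in>I. M)"
      using assms(1) by (intro sets_PiM_I_finite)
    have "emeasure (density (\<Pi>\<^sub>M i\<in>I. M) (\<lambda>z. \<Prod>i\<in>I. g (z i))) (Pi\<^sub>E I A)
        = (\<integral>\<^sup>+z. (\<Prod>i\<in>I. g (z i)) * indicator (Pi\<^sub>E I A) z \<partial>(\<Pi>\<^sub>M i\<in>I. M))"
      by (subst emeasure_density) auto
    also have "\<dots> = (\<integral>\<^sup>+z. (\<Prod>i\<in>I. g (z i) * indicator (A i) (z i)) \<partial>(\<Pi>\<^sub>M i\<in>I. M))"
    proof (intro nn_integral_cong)
      fix z assume "z \<in> space (\<Pi>\<^sub>M i\<in>I. M)"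
      then have "indicator (Pi\<^sub>E I A) z = (\<Prod>i\<in>I. indicator (A i) (z i) :: ennreal)"
        using assms(1) by (auto simp: space_PiM PiE_iff indicator_def intro!: prod_zero[symmetric])
      then show "(\<Prod>i\<in>I. g (z i)) * indicator (Pi\<^sub>E I A) z = (\<Prod>i\<in>I. g (z i) * indicator (A i) (z i))"
        by (simp add: prod.distrib)
    qed
    also have "\<dots> = (\<Prod>i\<in>I. \<integral>\<^sup>+x. g x * indicator (A i) x \<partial>M)"
      using A assms(1) by (subst M.product_nn_integral_prod) auto
    also have "\<dots> = (\<Prod>i\<in>I. emeasure (density M g) (A i))"
      using A by (intro prod.cong) (auto simp: emeasure_density)
    finally show "emeasure (density (\<Pi>\<^sub>M i\<in>I. M) (\<lambda>z. \<Prod>i\<in>I. g (z i))) (Pi\<^sub>E I A)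
        = (\<Prod>i\<in>I. emeasure (density M g) (A i))" .
  qed
qed

definition lik_ratio :: "nat \<Rightarrow> nat \<Rightarrow> real Matrix.vec \<Rightarrow> real \<Rightarrow> real Matrix.vec \<Rightarrow> real \<Rightarrow> data \<Rightarrow> real" where
  "lik_ratio n p \<beta>' \<sigma>' \<beta> \<sigma> z = (\<Prod>i<n. cond_density p \<beta>' \<sigma>' (z i) / cond_density p \<beta> \<sigma> (z i))"

lemma sets_data_law [simp, measurable_cong]: "sets (data_law n p \<theta>) = sets (data_space n p)"
  unfolding data_law_def data_space_def by (intro sets_PiM_cong) simp_all

lemma space_data_law [simp]: "space (data_law n p \<theta>) = space (data_space n p)"
  by (rule sets_eq_imp_space_eq) simp

lemma lik_ratio_measurable [measurable]:
  "lik_ratio n p \<beta>' \<sigma>' \<beta> \<sigma> \<in> borel_measurable (data_space n p)"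
  unfolding lik_ratio_def data_space_def by measurable

lemma lik_ratio_pos: "\<sigma> > 0 \<Longrightarrow> \<sigma>' > 0 \<Longrightarrow> lik_ratio n p \<beta>' \<sigma>' \<beta> \<sigma> z > 0"
  unfolding lik_ratio_def by (intro prod_pos ballI divide_pos_pos cond_density_pos)

lemma prob_space_data_law:
  assumes "\<beta> \<in> carrier_vec p" "\<sigma> > 0"
  shows "prob_space (data_law n p (\<beta>, 1\<^sub>m p, \<sigma>))"
  unfolding data_law_def by (intro prob_space_PiM prob_space_obs_law assms)

lemma data_law_density:
  assumes "\<beta> \<in> carrier_vec p" "\<beta>' \<in> carrier_vec p" "\<sigma> > 0" "\<sigma>' > 0"
  shows "data_law n p (\<beta>', 1\<^sub>m p, \<sigma>')
       = density (data_law n p (\<beta>, 1\<^sub>m p, \<sigma>)) (\<lambda>z. ennreal (lik_ratio n p \<beta>' \<sigma>' \<beta> \<sigma> z))"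
proof -
  have "ennreal (lik_ratio n p \<beta>' \<sigma>' \<beta> \<sigma> z)
      = (\<Prod>i<n. ennreal (cond_density p \<beta>' \<sigma>' (z i) / cond_density p \<beta> \<sigma> (z i)))" for z
    unfolding lik_ratio_def
    by (intro prod_ennreal[symmetric] divide_nonneg_nonneg less_imp_le cond_density_pos assms)
  then show ?thesis
    unfolding data_law_def obs_law_density[OF assms]
    by (subst PiM_density)
      (auto simp: prob_space_obs_law assms obs_law_density[OF assms, symmetric])
qed

lemma nn_integral_data_lik_ratio_product:
  assumes "\<beta> \<in> carrier_vec p" "\<delta> \<in> carrier_vec p" "\<delta>' \<in> carrier_vec p" "\<sigma> > 0" "s > 0" "s' > 0"
    and var: "s\<^sup>2 + (\<Sum>j<p. (vec_index \<delta> j)\<^sup>2) = \<sigma>\<^sup>2" "s'\<^sup>2 + (\<Sum>j<p. (vec_index \<delta>' j)\<^sup>2) = \<sigma>\<^sup>2"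
    and cov: "\<bar>\<Sum>j<p. vec_index \<delta> j * vec_index \<delta>' j\<bar> < \<sigma>\<^sup>2"
  shows "(\<integral>\<^sup>+z. ennreal (lik_ratio n p (\<beta> + \<delta>) s \<beta> \<sigma> z * lik_ratio n p (\<beta> + \<delta>') s' \<beta> \<sigma> z)
            \<partial>data_law n p (\<beta>, 1\<^sub>m p, \<sigma>))
       = ennreal ((\<sigma>\<^sup>2 / (\<sigma>\<^sup>2 - (\<Sum>j<p. vec_index \<delta> j * vec_index \<delta>' j))) ^ n)"
proof -
  interpret P: product_prob_space "\<lambda>_::nat. obs_law p (\<beta>, 1\<^sub>m p, \<sigma>)" "{..<n}"
    by (intro product_prob_spaceI prob_space_obs_law assms)
  let ?r = "\<lambda>z. cond_density p (\<beta> + \<delta>) s z / cond_density p \<beta> \<sigma> z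
             * (cond_density p (\<beta> + \<delta>') s' z / cond_density p \<beta> \<sigma> z)"
  have nonneg: "?r z \<ge> 0" for z
    by (intro mult_nonneg_nonneg divide_nonneg_nonneg less_imp_le cond_density_pos assms)
  have "(\<integral>\<^sup>+z. ennreal (lik_ratio n p (\<beta> + \<delta>) s \<beta> \<sigma> z * lik_ratio n p (\<beta> + \<delta>') s' \<beta> \<sigma> z)
            \<partial>data_law n p (\<beta>, 1\<^sub>m p, \<sigma>))
      = (\<integral>\<^sup>+z. (\<Prod>i<n. ennreal (?r (z i))) \<partial>data_law n p (\<beta>, 1\<^sub>m p, \<sigma>))"
    unfolding lik_ratio_def prod.distrib[symmetric] by (simp only: prod_ennreal[OF nonneg])
  also have "\<dots> = (\<Prod>i<n. \<integral>\<^sup>+z. ennreal (?r z) \<partial>obs_law p (\<beta>, 1\<^sub>m p, \<sigma>))"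
    unfolding data_law_def by (subst P.product_nn_integral_prod) auto
  also have "\<dots> = ennreal ((\<sigma>\<^sup>2 / (\<sigma>\<^sup>2 - (\<Sum>j<p. vec_index \<delta> j * vec_index \<delta>' j))) ^ n)"
    unfolding nn_integral_lik_ratio_product[OF assms] using cov by (simp add: ennreal_power)
  finally show ?thesis .
qed


section \<open>Length of confidence intervals from a second-moment bound\<close>

text \<open>An event that has probability at least \<open>b\<close> under each alternative density \<open>g w\<close> also has it under the
  uniform mixture \<open>F\<close>. The probabilities of one event under \<open>F\<close> and under \<open>M\<close> differ by at most the
  integral of \<open>F - 1\<close> over it, and this is at most the square root of \<open>E (F - 1)\<^sup>2 = E F\<^sup>2 - 1\<close>, where \<open>E F\<^sup>2\<close> is
  the average of the pairwise second moments. Bounds \<open>K\<close> are used for the latter, since only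
  their average has to be controlled.\<close>

lemma (in prob_space) chi_square_mixture_bound:
  fixes g :: "'w \<Rightarrow> 'a \<Rightarrow> real"
  assumes W: "finite W" "W \<noteq> {}" and \<eta>: "\<eta> > 0"
    and g [measurable]: "\<And>w. w \<in> W \<Longrightarrow> g w \<in> borel_measurable M"
    and nonneg: "\<And>w z. w \<in> W \<Longrightarrow> 0 \<le> g w z"
    and mass: "\<And>w. w \<in> W \<Longrightarrow> prob_space (density M (\<lambda>z. ennreal (g w z)))"
    and pair: "\<And>w w'. w \<in> W \<Longrightarrow> w' \<in> W \<Longrightarrow> (\<integral>\<^sup>+z. ennreal (g w z * g w' z) \<partial>M) \<le> ennreal (K w w')"
    and K_nonneg: "\<And>w w'. w \<in> W \<Longrightarrow> w' \<in> W \<Longrightarrow> 0 \<le> K w w'"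
    and chi: "(\<Sum>w\<in>W. \<Sum>w'\<in>W. K w w') \<le> (real (card W))\<^sup>2 * (1 + \<eta>\<^sup>2)"
    and B [measurable]: "B \<in> sets M"
    and prob_B: "\<And>w. w \<in> W \<Longrightarrow> b \<le> measure (density M (\<lambda>z. ennreal (g w z))) B"
  shows "b - \<eta> \<le> measure M B"
proof -
  define N where "N = real (card W)"
  have N: "N > 0" using W by (simp add: N_def card_gt_0_iff)
  have total: "(\<integral>\<^sup>+z. ennreal (g w z) \<partial>M) = 1" if "w \<in> W" for w
  proof -
    interpret G: prob_space "density M (\<lambda>z. ennreal (g w z))" using mass that .
    have "(\<integral>\<^sup>+z. ennreal (g w z) \<partial>M) = emeasure (density M (\<lambda>z. ennreal (g w z))) (space M)"
      using that by (subst emeasure_density) (auto cong: nn_integral_cong simp: indicator_def)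
    also have "\<dots> = 1" using G.emeasure_space_1 by simp
    finally show ?thesis .
  qed
  have int_g: "integrable M (g w)" and integral_g: "(\<integral>z. g w z \<partial>M) = 1" if "w \<in> W" for w
  proof -
    show "integrable M (g w)"
      using total[OF that] nonneg[OF that] g[OF that] by (intro integrableI_nonneg) auto
    then show "(\<integral>z. g w z \<partial>M) = 1"
      using total[OF that] nonneg[OF that] by (subst (asm) nn_integral_eq_integral) auto
  qed
  have int_gg: "integrable M (\<lambda>z. g w z * g w' z)" and integral_gg: "(\<integral>z. g w z * g w' z \<partial>M) \<le> K w w'"
    if "w \<in> W" "w' \<in> W" for w w'
  proof -
    have meas: "(\<lambda>z. g w z * g w' z) \<in> borel_measurable M" using that by measurable
    show *: "integrable M (\<lambda>z. g w z * g w' z)"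
      using pair[OF that] nonneg that meas
      by (intro integrableI_nonneg) (auto intro: le_less_trans)
    show "(\<integral>z. g w z * g w' z \<partial>M) \<le> K w w'"
      using pair[OF that] nonneg that K_nonneg[OF that] *
      by (subst (asm) nn_integral_eq_integral) auto
  qed
  have int_gB: "integrable M (\<lambda>z. g w z * indicator B z)" if "w \<in> W" for w
    using integrable_mult_indicator[OF B int_g[OF that]] by (simp add: mult.commute)
  have mass_B: "b \<le> (\<integral>z. g w z * indicator B z \<partial>M)" if "w \<in> W" for w
  proof -
    have "emeasure (density M (\<lambda>z. ennreal (g w z))) B = (\<integral>\<^sup>+z. ennreal (g w z * indicator B z) \<partial>M)"
      using that by (subst emeasure_density)
        (auto intro!: nn_integral_cong simp: indicator_def split: if_splits)
    also have "\<dots> = ennreal (\<integral>z. g w z * indicator B z \<partial>M)"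
      using int_gB[OF that] nonneg[OF that] by (intro nn_integral_eq_integral) auto
    finally have "measure (density M (\<lambda>z. ennreal (g w z))) B = (\<integral>z. g w z * indicator B z \<partial>M)"
      using nonneg[OF that] by (simp add: measure_def)
    then show ?thesis using prob_B[OF that] by simp
  qed
  define F where "F z = (\<Sum>w\<in>W. g w z) / N" for z
  have int_F: "integrable M F" unfolding F_def using int_g by auto
  have integral_F: "(\<integral>z. F z \<partial>M) = 1"
    unfolding F_def using int_g integral_g N by (simp add: N_def)
  have sq: "(F z)\<^sup>2 = (\<Sum>w\<in>W. \<Sum>w'\<in>W. g w z * g w' z) / N\<^sup>2" for z
    by (simp add: F_def power2_eq_square sum_product)
  have int_F2: "integrable M (\<lambda>z. (F z)\<^sup>2)"
    unfolding sq using int_gg by auto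
  have integral_F2: "(\<integral>z. (F z)\<^sup>2 \<partial>M) \<le> 1 + \<eta>\<^sup>2"
  proof -
    have "(\<integral>z. (F z)\<^sup>2 \<partial>M) = (\<Sum>w\<in>W. \<Sum>w'\<in>W. \<integral>z. g w z * g w' z \<partial>M) / N\<^sup>2"
      unfolding sq using int_gg by (simp add: Bochner_Integration.integral_sum)
    also have "\<dots> \<le> (\<Sum>w\<in>W. \<Sum>w'\<in>W. K w w') / N\<^sup>2"
      by (intro divide_right_mono sum_mono integral_gg) auto
    also have "\<dots> \<le> 1 + \<eta>\<^sup>2"
      using chi N by (simp add: N_def field_simps)
    finally show ?thesis .
  qed
  have int_B: "integrable M (indicator B :: 'a \<Rightarrow> real)"
    using B by (intro integrable_real_indicator) (simp_all add: emeasure_eq_measure)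
  have int_FB: "integrable M (\<lambda>z. F z * indicator B z)"
    using integrable_mult_indicator[OF B int_F] by (simp add: mult.commute)
  \<comment> \<open>The inequality \<open>x \<le> (x\<^sup>2 / \<eta> + \<eta>) / 2\<close> at \<open>x = F - 1\<close> replaces the Cauchy-Schwarz inequality.\<close>
  define h where "h z = ((1 / \<eta>) * ((F z)\<^sup>2 - 2 * F z + 1) + \<eta>) / 2" for z
  have h_ge: "F z - 1 \<le> h z" "0 \<le> h z" for z
  proof -
    have "0 \<le> (F z - 1 - \<eta>)\<^sup>2" by simp
    then show "F z - 1 \<le> h z"
      using \<eta> by (simp add: h_def field_simps power2_eq_square)
    have "(F z)\<^sup>2 - 2 * F z + 1 = (F z - 1)\<^sup>2"
      by (simp add: power2_eq_square algebra_simps)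
    then show "0 \<le> h z" using \<eta> by (simp add: h_def)
  qed
  have int_h: "integrable M h" unfolding h_def using int_F int_F2 by simp
  have integral_h: "(\<integral>z. h z \<partial>M) = ((1 / \<eta>) * ((\<integral>z. (F z)\<^sup>2 \<partial>M) - 1) + \<eta>) / 2"
    unfolding h_def using int_F int_F2 by (simp add: integral_F prob_space)
  have "b \<le> (\<Sum>w\<in>W. \<integral>z. g w z * indicator B z \<partial>M) / N"
  proof -
    have "N * b = (\<Sum>w\<in>W. b)" by (simp add: N_def)
    also have "\<dots> \<le> (\<Sum>w\<in>W. \<integral>z. g w z * indicator B z \<partial>M)" by (intro sum_mono mass_B)
    finally show ?thesis using N by (simp add: field_simps)
  qed
  also have "\<dots> = (\<integral>z. F z * indicator B z \<partial>M)"
    unfolding F_def using int_gB by (simp add: sum_distrib_right Bochner_Integration.integral_sum)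
  also have "\<dots> \<le> (\<integral>z. indicator B z + h z \<partial>M)"
  proof (rule integral_mono)
    show "integrable M (\<lambda>z. F z * indicator B z)" by (fact int_FB)
    show "integrable M (\<lambda>z. indicator B z + h z)" using int_h int_B by simp
    show "F z * indicator B z \<le> indicator B z + h z" for z
      using h_ge[of z] by (auto simp: indicator_def)
  qed
  also have "\<dots> = measure M B + ((1 / \<eta>) * ((\<integral>z. (F z)\<^sup>2 \<partial>M) - 1) + \<eta>) / 2"
    using int_h int_B integral_h by simp
  also have "\<dots> \<le> measure M B + ((1 / \<eta>) * \<eta>\<^sup>2 + \<eta>) / 2"
    using integral_F2 \<eta> by (intro add_left_mono divide_right_mono add_right_mono mult_left_mono) auto
  also have "\<dots> = measure M B + \<eta>" using \<eta> by (simp add: power2_eq_square)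
  finally show ?thesis by simp
qed

lemma conf_intervals_coverage:
  assumes "(l, u) \<in> conf_intervals n p \<alpha> \<Theta> T" "\<theta> \<in> \<Theta>"
  shows "1 - \<alpha> \<le> measure (data_law n p \<theta>)
           {z \<in> space (data_space n p). l z \<le> T (fst \<theta>) \<and> T (fst \<theta>) \<le> u z}"
proof -
  let ?c = "\<lambda>\<theta>. measure (data_law n p \<theta>)
           {z \<in> space (data_law n p \<theta>). l z \<le> T (fst \<theta>) \<and> T (fst \<theta>) \<le> u z}"
  have "1 - \<alpha> \<le> (INF \<theta>\<in>\<Theta>. ?c \<theta>)" using assms(1) by (simp add: conf_intervals_def)
  also have "\<dots> \<le> ?c \<theta>"
    by (intro cINF_lower assms(2)) (auto intro!: bdd_belowI[of _ 0])
  finally show ?thesis by simp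
qed

text \<open>If the upper end is above \<open>T + G\<close> with probability at least \<open>1 - \<alpha> - \<eta>\<close> under the same \<open>\<theta>\<close> under which the
  interval covers \<open>T\<close>, then both events occur together with probability at least \<open>1 - 2\<alpha> - \<eta>\<close>, and there the
  interval contains \<open>[T, T + G]\<close>.\<close>

lemma expected_length_ge:
  assumes CI: "(l, u) \<in> conf_intervals n p \<alpha> \<Theta> T" and "\<theta> \<in> \<Theta>"
    and "prob_space (data_law n p \<theta>)" and "0 \<le> G"
    and upper: "1 - \<alpha> - \<eta> \<le> measure (data_law n p \<theta>) {z \<in> space (data_space n p). T (fst \<theta>) + G \<le> u z}"
  shows "ennreal (G * (1 - 2 * \<alpha> - \<eta>)) \<le> expected_length n p \<theta> (l, u)"
proof -
  interpret P: prob_space "data_law n p \<theta>" by fact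
  have [measurable]: "l \<in> borel_measurable (data_space n p)" "u \<in> borel_measurable (data_space n p)"
    using CI by (auto simp: conf_intervals_def)
  define A where "A = {z \<in> space (data_space n p). l z \<le> T (fst \<theta>) \<and> T (fst \<theta>) \<le> u z}"
  define B where "B = {z \<in> space (data_space n p). T (fst \<theta>) + G \<le> u z}"
  have [measurable]: "A \<in> sets (data_space n p)" "B \<in> sets (data_space n p)"
    unfolding A_def B_def by measurable
  have "1 - \<alpha> \<le> P.prob A" using conf_intervals_coverage[OF CI assms(2)] by (simp add: A_def)
  moreover have "1 - \<alpha> - \<eta> \<le> P.prob B" using upper by (simp add: B_def)
  moreover have "P.prob (A \<inter> B) = P.prob A + P.prob B - P.prob (A \<union> B)"
    using P.finite_measure_Union'[of A B] P.finite_measure_Diff'[of B A] by (simp add: Int_commute)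
  moreover have "P.prob (A \<union> B) \<le> 1" by (rule P.prob_le_1)
  ultimately have "1 - 2 * \<alpha> - \<eta> \<le> P.prob (A \<inter> B)" by linarith
  then have "ennreal (G * (1 - 2 * \<alpha> - \<eta>)) \<le> ennreal (G * P.prob (A \<inter> B))"
    using assms(4) by (intro ennreal_leI mult_left_mono)
  also have "\<dots> = (\<integral>\<^sup>+z. ennreal G * indicator (A \<inter> B) z \<partial>data_law n p \<theta>)"
    using assms(4) by (simp add: nn_integral_cmult_indicator P.emeasure_eq_measure ennreal_mult')
  also have "\<dots> \<le> (\<integral>\<^sup>+z. ennreal (u z - l z) \<partial>data_law n p \<theta>)"
    by (intro nn_integral_mono) (auto simp: A_def B_def indicator_def intro!: ennreal_leI)
  finally show ?thesis by (simp add: expected_length_def)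
qed


section \<open>Mixtures of sparse perturbations\<close>

lemma disjoint_blocks:
  assumes "finite S" "s * m \<le> card S"
  obtains B :: "nat \<Rightarrow> 'a set" where "\<And>b. b < s \<Longrightarrow> B b \<subseteq> S" "\<And>b. b < s \<Longrightarrow> card (B b) = m"
    "disjoint_family_on B {..<s}"
proof -
  obtain e where e: "bij_betw e {0..<card S} S" using assms(1) ex_bij_betw_nat_finite by blast
  have sub: "{b * m..<b * m + m} \<subseteq> {0..<card S}" if "b < s" for b
  proof -
    have "(b + 1) * m \<le> s * m" using that by (intro mult_right_mono) auto
    then show ?thesis using assms(2) by auto
  qed
  have inj: "inj_on e {0..<card S}" using e by (simp add: bij_betw_def)
  have apart: "{b * m..<b * m + m} \<inter> {b' * m..<b' * m + m} = {}" if "b < b'" for b b' :: nat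
  proof -
    have "(b + 1) * m \<le> b' * m" using that by (intro mult_right_mono) auto
    then show ?thesis by auto
  qed
  show thesis
  proof (rule that[of "\<lambda>b. e ` {b * m..<b * m + m}"])
    show "e ` {b * m..<b * m + m} \<subseteq> S" if "b < s" for b
      using sub[OF that] e by (auto simp: bij_betw_def)
    show "card (e ` {b * m..<b * m + m}) = m" if "b < s" for b
      using card_image[OF inj_on_subset[OF inj sub[OF that]]] by simp
    show "disjoint_family_on (\<lambda>b. e ` {b * m..<b * m + m}) {..<s}"
      unfolding disjoint_family_on_def
    proof (intro ballI impI)
      fix b b' assume b: "b \<in> {..<s}" "b' \<in> {..<s}" "b \<noteq> b'"
      then have "{b * m..<b * m + m} \<inter> {b' * m..<b' * m + m} = {}"
        using apart[of b b'] apart[of b' b] by (cases "b < b'") auto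
      then show "e ` {b * m..<b * m + m} \<inter> e ` {b' * m..<b' * m + m} = {}"
        using inj_on_image_Int[OF inj sub[of b] sub[of b']] b by (metis image_empty lessThan_iff)
    qed
  qed
qed

text \<open>For \<open>w\<close> and \<open>w'\<close> drawn independently and uniformly from the product of the blocks, the number of
  blocks in which they agree is binomial with parameters \<open>s\<close> and \<open>1/m\<close>; the sum is \<open>(card W)\<^sup>2\<close> times its
  generating function \<open>(1 + (x - 1) / m) ^ s\<close> at \<open>x\<close>, and \<open>1 + y \<le> exp y\<close> gives the bound. This is the
  reason for sampling one index per block instead of a uniform \<open>s\<close>-subset, whose overlaps are hypergeometric.\<close>

lemma agreement_sum:
  fixes x :: real and B :: "nat \<Rightarrow> 'a set"
  assumes B: "\<And>b. b < s \<Longrightarrow> finite (B b)" "\<And>b. b < s \<Longrightarrow> card (B b) = m" and "m > 0" "x \<ge> 1"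
  defines "W \<equiv> PiE {..<s} B"
  shows "(\<Sum>w\<in>W. \<Sum>w'\<in>W. \<Prod>b<s. if w b = w' b then x else 1)
    \<le> (real (card W))\<^sup>2 * exp (real s * (x - 1) / real m)"
proof -
  have card_W: "real (card W) = real m ^ s"
    unfolding W_def using B by (subst card_PiE) auto
  have inner: "(\<Sum>w'\<in>W. \<Prod>b<s. if w b = w' b then x else 1) = (real m + (x - 1)) ^ s" if "w \<in> W" for w
  proof -
    have "(\<Sum>w'\<in>W. \<Prod>b<s. if w b = w' b then x else 1) = (\<Prod>b<s. \<Sum>j\<in>B b. if w b = j then x else 1)"
      unfolding W_def using B by (subst prod_sum_PiE) auto
    also have "\<dots> = (\<Prod>b<s. real m + (x - 1))"
    proof (intro prod.cong refl)
      fix b assume "b \<in> {..<s}"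
      then have b: "w b \<in> B b" "finite (B b)" "card (B b) = m" using that B by (auto simp: W_def)
      have "(\<Sum>j\<in>B b. if w b = j then x else 1) = (\<Sum>j\<in>B b. 1 + (if w b = j then x - 1 else 0))"
        by (intro sum.cong) auto
      also have "\<dots> = real m + (x - 1)" using b by (simp add: sum.distrib)
      finally show "(\<Sum>j\<in>B b. if w b = j then x else 1) = real m + (x - 1)" .
    qed
    finally show ?thesis by simp
  qed
  have "real m + (x - 1) = real m * (1 + (x - 1) / real m)"
    using assms(3) by (simp add: field_simps)
  then have "(real m + (x - 1)) ^ s = real m ^ s * (1 + (x - 1) / real m) ^ s"
    by (simp only: power_mult_distrib)
  also have "\<dots> \<le> real m ^ s * (exp ((x - 1) / real m)) ^ s"
    using assms(4) by (intro mult_left_mono power_mono exp_ge_add_one_self) auto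
  also have "\<dots> = real m ^ s * exp (real s * (x - 1) / real m)"
    by (simp add: exp_of_nat_mult[symmetric])
  finally have "real m ^ s * (real m + (x - 1)) ^ s \<le> real m ^ s * (real m ^ s * exp (real s * (x - 1) / real m))"
    by (intro mult_left_mono) auto
  then show ?thesis
    by (simp add: inner card_W power2_eq_square mult.assoc)
qed

lemma inverse_power_le_exp:
  fixes x :: real
  assumes "0 \<le> x" "x \<le> 1 / 2"
  shows "(1 / (1 - x)) ^ n \<le> exp (2 * real n * x)"
proof -
  have "0 \<le> x * (1 - 2 * x)" using assms by simp
  then have "1 \<le> (1 + 2 * x) * (1 - x)" by (simp add: algebra_simps)
  then have "1 / (1 - x) \<le> 1 + 2 * x" using assms by (simp add: divide_simps)
  also have "\<dots> \<le> exp (2 * x)" by (rule exp_ge_add_one_self)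
  finally have "(1 / (1 - x)) ^ n \<le> exp (2 * x) ^ n" using assms by (intro power_mono) auto
  also have "\<dots> = exp (2 * real n * x)" by (simp add: exp_of_nat_mult[symmetric] mult_ac)
  finally show ?thesis .
qed

text \<open>Aligning the signs with those of \<open>\<xi>\<close> makes all the contributions to the scalar product with \<open>\<xi>\<close>
  positive, while the scalar product of two directions only counts common indices.\<close>

definition signed_direction :: "nat \<Rightarrow> real Matrix.vec \<Rightarrow> real \<Rightarrow> nat set \<Rightarrow> real Matrix.vec" where
  "signed_direction p \<xi> \<rho> S = Matrix.vec p (\<lambda>j. if j \<in> S then \<rho> * sgn (vec_index \<xi> j) else 0)"

lemma signed_direction_carrier [simp]: "signed_direction p \<xi> \<rho> S \<in> carrier_vec p"
  by (simp add: signed_direction_def)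

lemma sum_signed_direction_product:
  assumes "\<xi> \<in> carrier_vec p" "S \<subseteq> supp \<xi>" "S' \<subseteq> supp \<xi>"
  shows "(\<Sum>j<p. vec_index (signed_direction p \<xi> \<rho> S) j * vec_index (signed_direction p \<xi> \<rho> S') j)
       = \<rho>\<^sup>2 * real (card (S \<inter> S'))"
proof -
  have sub: "S \<inter> S' \<subseteq> {..<p}" using assms by (auto simp: supp_def)
  have "(\<Sum>j<p. vec_index (signed_direction p \<xi> \<rho> S) j * vec_index (signed_direction p \<xi> \<rho> S') j)
      = (\<Sum>j<p. if j \<in> S \<inter> S' then \<rho>\<^sup>2 else 0)"
    using assms by (intro sum.cong) (auto simp: signed_direction_def supp_def power2_eq_square sgn_if)
  also have "\<dots> = (\<Sum>j\<in>S \<inter> S'. \<rho>\<^sup>2)"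
    using sum.inter_restrict[of "{..<p}" "\<lambda>_. \<rho>\<^sup>2" "S \<inter> S'"] sub by (simp only: Int_absorb1 finite_lessThan)
  finally show ?thesis by simp
qed

lemma scalar_prod_signed_direction:
  assumes "\<xi> \<in> carrier_vec p" "S \<subseteq> supp \<xi>"
  shows "scalar_prod \<xi> (signed_direction p \<xi> \<rho> S) = \<rho> * (\<Sum>j\<in>S. \<bar>vec_index \<xi> j\<bar>)"
proof -
  have sub: "S \<subseteq> {..<p}" using assms by (auto simp: supp_def)
  have "scalar_prod \<xi> (signed_direction p \<xi> \<rho> S) = (\<Sum>j<p. if j \<in> S then \<rho> * \<bar>vec_index \<xi> j\<bar> else 0)"
    unfolding scalar_prod_def signed_direction_def
    by (auto simp: atLeast0LessThan abs_sgn intro!: sum.cong)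
  also have "\<dots> = (\<Sum>j\<in>S. \<rho> * \<bar>vec_index \<xi> j\<bar>)"
    using sum.inter_restrict[of "{..<p}" "\<lambda>j. \<rho> * \<bar>vec_index \<xi> j\<bar>" S] sub by (simp only: Int_absorb1 finite_lessThan)
  finally show ?thesis by (simp add: sum_distrib_left)
qed

lemma l0_norm_add_signed_direction:
  assumes "\<beta> \<in> carrier_vec p" "finite S"
  shows "l0_norm (\<beta> + signed_direction p \<xi> \<rho> S) \<le> l0_norm \<beta> + card S"
proof -
  have "supp (\<beta> + signed_direction p \<xi> \<rho> S) \<subseteq> supp \<beta> \<union> S"
    using assms(1) by (auto simp: supp_def signed_direction_def split: if_splits)
  moreover have "finite (supp \<beta> \<union> S)" using assms(2) by (simp add: supp_def)
  ultimately have "card (supp (\<beta> + signed_direction p \<xi> \<rho> S)) \<le> card (supp \<beta> \<union> S)"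
    by (intro card_mono)
  also have "\<dots> \<le> card (supp \<beta>) + card S" by (rule card_Un_le)
  finally show ?thesis by (simp add: l0_norm_def)
qed

text \<open>The bound for given dimensions and free design parameters: \<open>s\<close> perturbed entries, each of size
  \<open>\<sigma> * sqrt r\<close>. The condition \<open>s * r \<le> 1/2\<close> keeps the noise level of the alternatives positive, and the
  exponential condition is the bound on the second moment of the mixed likelihood ratio. The number of
  nonzero entries is subadditive, so \<open>l0_norm \<beta> + s \<le> k\<close> puts the alternatives into the parameter space
  wherever the perturbation is supported.\<close>

lemma expected_length_lower_bound:
  fixes n p s k :: nat and r x \<eta> \<alpha> :: real
  assumes \<theta>: "(\<beta>, 1\<^sub>m p, \<sigma>) \<in> Theta p M1 M2 k" and \<xi>: "\<xi> \<in> carrier_vec p"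
    and sparse: "l0_norm \<beta> + s \<le> k"
    and s: "0 < s" "s \<le> l0_norm \<xi>"
    and r: "0 \<le> r" "real s * r \<le> 1 / 2"
    and \<eta>: "\<eta> > 0"
      "exp (real s * (exp (2 * real n * r) - 1) / real (l0_norm \<xi> div s)) \<le> 1 + \<eta>\<^sup>2"
    and x: "0 \<le> x" "\<And>j. j \<in> supp \<xi> \<Longrightarrow> x \<le> \<bar>vec_index \<xi> j\<bar>"
    and CI: "CI \<in> conf_intervals n p \<alpha> (Theta p M1 M2 k) (\<lambda>b. scalar_prod \<xi> b)"
  shows "ennreal (\<sigma> * sqrt r * real s * x * (1 - 2 * \<alpha> - \<eta>))
    \<le> expected_length n p (\<beta>, 1\<^sub>m p, \<sigma>) CI"
proof -
  obtain l u where CI_eq: "CI = (l, u)" by (cases CI)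
  note CI' = CI[unfolded CI_eq]
  have [measurable]: "l \<in> borel_measurable (data_space n p)" "u \<in> borel_measurable (data_space n p)"
    using CI' by (auto simp: conf_intervals_def)
  have \<beta>: "\<beta> \<in> carrier_vec p" and \<sigma>: "0 < \<sigma>" "\<sigma> \<le> M2"
    using \<theta> by (auto simp: Theta_def)
  define m where "m = l0_norm \<xi> div s"
  have m: "m > 0" using s by (simp add: m_def div_greater_zero_iff)
  have fin: "finite (supp \<xi>)" by (simp add: supp_def)
  obtain B where B: "\<And>b. b < s \<Longrightarrow> B b \<subseteq> supp \<xi>" "\<And>b. b < s \<Longrightarrow> card (B b) = m"
      "disjoint_family_on B {..<s}"
    using disjoint_blocks[OF fin, of s m] by (auto simp: m_def l0_norm_def)
  have finB: "finite (B b)" if "b < s" for b using B(1)[OF that] fin by (rule finite_subset)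
  define W where "W = PiE {..<s} B"
  have W: "finite W" "W \<noteq> {}"
  proof -
    show "finite W" unfolding W_def using finB by (intro finite_PiE) auto
    have "B b \<noteq> {}" if "b < s" for b using B(2)[OF that] m by auto
    then show "W \<noteq> {}" by (simp add: W_def PiE_eq_empty_iff)
  qed
  define \<rho> where "\<rho> = \<sigma> * sqrt r"
  have \<rho>: "0 \<le> \<rho>" "\<rho>\<^sup>2 = \<sigma>\<^sup>2 * r" using \<sigma> r by (auto simp: \<rho>_def power_mult_distrib)
  define \<delta> where "\<delta> w = signed_direction p \<xi> \<rho> (w ` {..<s})" for w
  have \<delta>_carrier: "\<delta> w \<in> carrier_vec p" for w by (simp add: \<delta>_def)
  have w_mem: "w b \<in> B b" if "w \<in> W" "b < s" for w b using that by (auto simp: W_def)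
  have w_sub: "w ` {..<s} \<subseteq> supp \<xi>" if "w \<in> W" for w
    using w_mem[OF that] B(1) by blast
  \<comment> \<open>The blocks are disjoint, so equal values can only come from the same block.\<close>
  have same_block: "b = b'" if "w \<in> W" "w' \<in> W" "b < s" "b' < s" "w b = w' b'" for w w' b b'
    using B(3) w_mem[OF that(1,3)] w_mem[OF that(2,4)] that
    by (auto simp: disjoint_family_on_def)
  have w_inj: "inj_on w {..<s}" if "w \<in> W" for w
    using same_block[OF that that] by (auto simp: inj_on_def)
  define J where "J w w' = card {b. b < s \<and> w b = w' b}" for w w' :: "nat \<Rightarrow> nat"
  have J_le: "J w w' \<le> s" for w w'
    unfolding J_def using card_mono[of "{..<s}" "{b. b < s \<and> w b = w' b}"] by auto
  have inner: "(\<Sum>j<p. vec_index (\<delta> w) j * vec_index (\<delta> w') j) = \<sigma>\<^sup>2 * (r * real (J w w'))"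
    if "w \<in> W" "w' \<in> W" for w w'
  proof -
    have "w ` {..<s} \<inter> w' ` {..<s} = w ` {b. b < s \<and> w b = w' b}"
      using same_block[OF that] by (fastforce simp: image_iff)
    moreover have "card (w ` {b. b < s \<and> w b = w' b}) = J w w'"
      unfolding J_def by (intro card_image inj_on_subset[OF w_inj[OF that(1)]]) auto
    ultimately show ?thesis
      unfolding \<delta>_def sum_signed_direction_product[OF \<xi> w_sub[OF that(1)] w_sub[OF that(2)]]
      by (simp add: \<rho>)
  qed
  have rJ: "0 \<le> r * real (J w w')" "r * real (J w w') \<le> 1 / 2" for w w'
  proof -
    show "0 \<le> r * real (J w w')" using r by simp
    have "r * real (J w w') \<le> r * real s" using J_le r by (intro mult_left_mono) auto
    then show "r * real (J w w') \<le> 1 / 2" using r by (simp add: mult.commute)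
  qed
  define \<sigma>' where "\<sigma>' = \<sigma> * sqrt (1 - real s * r)"
  have \<sigma>': "0 < \<sigma>'" "\<sigma>' \<le> \<sigma>" "\<sigma>'\<^sup>2 = \<sigma>\<^sup>2 * (1 - real s * r)"
  proof -
    show "0 < \<sigma>'" "\<sigma>'\<^sup>2 = \<sigma>\<^sup>2 * (1 - real s * r)" using r \<sigma> by (simp_all add: \<sigma>'_def power_mult_distrib)
    have "sqrt (1 - real s * r) \<le> 1" using r by simp
    then show "\<sigma>' \<le> \<sigma>" using \<sigma> by (simp add: \<sigma>'_def mult_left_le)
  qed
  have variance: "\<sigma>'\<^sup>2 + (\<Sum>j<p. (vec_index (\<delta> w) j)\<^sup>2) = \<sigma>\<^sup>2" if "w \<in> W" for w
  proof -
    have "J w w = s" by (simp add: J_def)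
    then show ?thesis using inner[OF that that] \<sigma>'(3) by (simp add: algebra_simps flip: power2_eq_square)
  qed
  have in_Theta: "(\<beta> + \<delta> w, 1\<^sub>m p, \<sigma>') \<in> Theta p M1 M2 k" if "w \<in> W" for w
  proof -
    have "l0_norm (\<beta> + \<delta> w) \<le> l0_norm \<beta> + card (w ` {..<s})"
      unfolding \<delta>_def using \<beta> by (intro l0_norm_add_signed_direction) auto
    also have "\<dots> \<le> k" using sparse card_image[OF w_inj[OF that]] by simp
    finally show ?thesis using \<theta> \<sigma>' \<delta>_carrier[of w] by (auto simp: Theta_def)
  qed
  define G where "G = \<rho> * (real s * x)"
  have gap: "scalar_prod \<xi> \<beta> + G \<le> scalar_prod \<xi> (\<beta> + \<delta> w)" if "w \<in> W" for w
  proof -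
    have "real s * x = (\<Sum>j\<in>w ` {..<s}. x)" using card_image[OF w_inj[OF that]] by simp
    also have "\<dots> \<le> (\<Sum>j\<in>w ` {..<s}. \<bar>vec_index \<xi> j\<bar>)"
      using w_sub[OF that] x by (intro sum_mono) auto
    finally have "G \<le> scalar_prod \<xi> (\<delta> w)"
      unfolding \<delta>_def scalar_prod_signed_direction[OF \<xi> w_sub[OF that]] G_def
      using \<rho> by (intro mult_left_mono)
    then show ?thesis using scalar_prod_add_distrib[OF \<xi> \<beta> \<delta>_carrier[of w]] by simp
  qed
  interpret P: prob_space "data_law n p (\<beta>, 1\<^sub>m p, \<sigma>)" using \<beta> \<sigma> by (intro prob_space_data_law)
  define R where "R w = lik_ratio n p (\<beta> + \<delta> w) \<sigma>' \<beta> \<sigma>" for w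
  have alt: "density (data_law n p (\<beta>, 1\<^sub>m p, \<sigma>)) (\<lambda>z. ennreal (R w z)) = data_law n p (\<beta> + \<delta> w, 1\<^sub>m p, \<sigma>')" for w
    unfolding R_def using \<beta> \<delta>_carrier \<sigma> \<sigma>' by (intro data_law_density[symmetric]) auto
  define \<nu> where "\<nu> = exp (2 * real n * r)"
  have \<nu>: "\<nu> \<ge> 1" using r by (simp add: \<nu>_def)
  \<comment> \<open>All alternatives shift the functional by at least \<open>G\<close>, so covering it forces the upper end
    into one common event.\<close>
  define E where "E = {z \<in> space (data_space n p). scalar_prod \<xi> \<beta> + G \<le> u z}"
  have E [measurable]: "E \<in> sets (data_space n p)" unfolding E_def by measurable
  have "1 - \<alpha> - \<eta> \<le> P.prob E"
  proof (rule P.chi_square_mixture_bound[OF W \<eta>(1), where g = R and K = "\<lambda>w w'. \<Prod>b<s. if w b = w' b then \<nu> else 1"])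
    fix w assume w: "w \<in> W"
    show "R w \<in> borel_measurable (data_law n p (\<beta>, 1\<^sub>m p, \<sigma>))" unfolding R_def by measurable
    show "0 \<le> R w z" for z unfolding R_def using lik_ratio_pos \<sigma> \<sigma>' by (simp add: less_imp_le)
    show "prob_space (density (data_law n p (\<beta>, 1\<^sub>m p, \<sigma>)) (\<lambda>z. ennreal (R w z)))"
      unfolding alt using \<beta> \<delta>_carrier \<sigma>' by (intro prob_space_data_law) auto
    interpret Q: prob_space "data_law n p (\<beta> + \<delta> w, 1\<^sub>m p, \<sigma>')"
      using \<beta> \<delta>_carrier \<sigma>' by (intro prob_space_data_law) auto
    have "1 - \<alpha> \<le> Q.prob {z \<in> space (data_space n p).
        l z \<le> scalar_prod \<xi> (\<beta> + \<delta> w) \<and> scalar_prod \<xi> (\<beta> + \<delta> w) \<le> u z}"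
      using conf_intervals_coverage[OF CI' in_Theta[OF w]] by simp
    also have "\<dots> \<le> Q.prob E"
      using gap[OF w] by (intro Q.finite_measure_mono) (auto simp: E_def)
    finally show "1 - \<alpha> \<le> measure (density (data_law n p (\<beta>, 1\<^sub>m p, \<sigma>)) (\<lambda>z. ennreal (R w z))) E"
      unfolding alt .
    fix w' assume w': "w' \<in> W"
    show "0 \<le> (\<Prod>b<s. if w b = w' b then \<nu> else 1)" using \<nu> by (intro prod_nonneg) auto
    have "\<sigma>\<^sup>2 * (r * real (J w w')) \<le> \<sigma>\<^sup>2 * (1 / 2)"
      using rJ by (intro mult_left_mono) auto
    moreover have "0 < \<sigma>\<^sup>2" using \<sigma> by simp
    ultimately have cov: "\<bar>\<Sum>j<p. vec_index (\<delta> w) j * vec_index (\<delta> w') j\<bar> < \<sigma>\<^sup>2"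
      unfolding inner[OF w w'] using rJ(1)[of w w'] by simp
    have "(\<integral>\<^sup>+z. ennreal (R w z * R w' z) \<partial>data_law n p (\<beta>, 1\<^sub>m p, \<sigma>))
        = ennreal ((\<sigma>\<^sup>2 / (\<sigma>\<^sup>2 - \<sigma>\<^sup>2 * (r * real (J w w')))) ^ n)"
      unfolding R_def inner[OF w w', symmetric]
      by (rule nn_integral_data_lik_ratio_product) (use \<beta> \<delta>_carrier \<sigma> \<sigma>' variance w w' cov in auto)
    also have "\<sigma>\<^sup>2 / (\<sigma>\<^sup>2 - \<sigma>\<^sup>2 * (r * real (J w w'))) = 1 / (1 - r * real (J w w'))"
    proof -
      have "\<sigma>\<^sup>2 - \<sigma>\<^sup>2 * (r * real (J w w')) = \<sigma>\<^sup>2 * (1 - r * real (J w w'))" by (simp add: algebra_simps)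
      then show ?thesis using \<sigma> by simp
    qed
    also have "(1 / (1 - r * real (J w w'))) ^ n \<le> exp (2 * real n * (r * real (J w w')))"
      by (intro inverse_power_le_exp rJ)
    also have "\<dots> = \<nu> ^ J w w'"
      by (simp add: \<nu>_def exp_of_nat_mult[symmetric] mult_ac)
    also have "\<dots> = (\<Prod>b<s. if w b = w' b then \<nu> else 1)"
      by (subst prod.inter_filter[symmetric]) (auto simp: J_def)
    finally show "(\<integral>\<^sup>+z. ennreal (R w z * R w' z) \<partial>data_law n p (\<beta>, 1\<^sub>m p, \<sigma>))
        \<le> ennreal (\<Prod>b<s. if w b = w' b then \<nu> else 1)"
      by (auto intro: ennreal_leI)
  next
    have "(\<Sum>w\<in>W. \<Sum>w'\<in>W. \<Prod>b<s. if w b = w' b then \<nu> else 1)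
        \<le> (real (card W))\<^sup>2 * exp (real s * (\<nu> - 1) / real m)"
      unfolding W_def by (rule agreement_sum) (use finB B m \<nu> in auto)
    also have "\<dots> \<le> (real (card W))\<^sup>2 * (1 + \<eta>\<^sup>2)"
      using \<eta>(2) by (intro mult_left_mono) (auto simp: m_def \<nu>_def)
    finally show "(\<Sum>w\<in>W. \<Sum>w'\<in>W. \<Prod>b<s. if w b = w' b then \<nu> else 1) \<le> (real (card W))\<^sup>2 * (1 + \<eta>\<^sup>2)" .
  qed simp
  then have "ennreal (G * (1 - 2 * \<alpha> - \<eta>)) \<le> expected_length n p (\<beta>, 1\<^sub>m p, \<sigma>) (l, u)"
    using \<rho> x by (intro expected_length_ge[OF CI' \<theta> P.prob_space_axioms]) (auto simp: G_def E_def)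
  then show ?thesis by (simp add: CI_eq G_def \<rho>_def mult_ac)
qed


section \<open>The dense loading regime\<close>

lemma linf_norm_le_of_Xi:
  assumes "\<xi> \<in> Xi p q cbar" "cbar \<ge> 1" "j \<in> supp \<xi>"
  shows "linf_norm \<xi> / cbar \<le> \<bar>vec_index \<xi> j\<bar>"
proof -
  let ?A = "(\<lambda>j. \<bar>vec_index \<xi> j\<bar>) ` supp \<xi>"
  have fin: "finite ?A" by (simp add: supp_def)
  have ne: "?A \<noteq> {}" using assms(3) by auto
  have "Min ?A \<in> ?A" using fin ne by (rule Min_in)
  then have Min_pos: "Min ?A > 0" by (auto simp: supp_def)
  have "Max ?A / Min ?A \<le> cbar" using assms(1) by (simp add: Xi_def)
  then have "Max ?A \<le> cbar * Min ?A" using Min_pos by (simp add: divide_simps)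
  also have "\<dots> \<le> cbar * \<bar>vec_index \<xi> j\<bar>"
    using assms fin by (intro mult_left_mono Min_le) auto
  finally have Max_le: "Max ?A \<le> cbar * \<bar>vec_index \<xi> j\<bar>" .
  have "\<bar>vec_index \<xi> i\<bar> \<le> cbar * \<bar>vec_index \<xi> j\<bar>" if "i < dim_vec \<xi>" for i
  proof (cases "i \<in> supp \<xi>")
    case True
    then have "\<bar>vec_index \<xi> i\<bar> \<le> Max ?A" using fin by (intro Max_ge) auto
    then show ?thesis using Max_le by simp
  next
    case False
    then show ?thesis using that assms(2) by (simp add: supp_def)
  qed
  moreover have "{..<dim_vec \<xi>} \<noteq> {}" using assms(3) by (auto simp: supp_def)
  ultimately have "linf_norm \<xi> \<le> cbar * \<bar>vec_index \<xi> j\<bar>"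
    unfolding linf_norm_def by (subst Max_le_iff) auto
  then show ?thesis using assms(2) by (simp add: divide_simps mult.commute)
qed

lemma linf_norm_nonneg:
  assumes "dim_vec x > 0"
  shows "0 \<le> linf_norm x"
proof -
  have "\<bar>vec_index x 0\<bar> \<le> linf_norm x"
    unfolding linf_norm_def using assms by (intro Max_ge) auto
  then show ?thesis by linarith
qed

text \<open>Used with \<open>x = p\<close>: the growth \<open>p\<^sup>a - 1\<close> of the second moment is beaten by \<open>p\<close> to the power \<open>\<epsilon>\<close>, with a factor that
  tends to zero with \<open>a\<close> uniformly in \<open>p\<close>. Hence small \<open>p\<close> need no separate argument. With \<open>y = a ln x\<close>, it
  follows from \<open>e\<^sup>y - 1 \<le> y e\<^sup>y\<close> and from \<open>z \<le> e\<^sup>z\<close> at \<open>z = \<epsilon> ln x / 2\<close>.\<close>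

lemma powr_minus_one_le:
  fixes x a \<epsilon> :: real
  assumes "0 < a" "a \<le> \<epsilon> / 2" "1 \<le> x"
  shows "x powr a - 1 \<le> 2 * a / \<epsilon> * x powr \<epsilon>"
proof -
  define L where "L = ln x"
  have L: "0 \<le> L" using assms(3) by (simp add: L_def)
  have x: "x powr t = exp (t * L)" for t using assms(3) by (simp add: powr_def L_def)
  have "1 + - (a * L) \<le> exp (- (a * L))" by (rule exp_ge_add_one_self)
  then have "(1 - a * L) * exp (a * L) \<le> exp (- (a * L)) * exp (a * L)"
    by (intro mult_right_mono) auto
  then have "exp (a * L) - 1 \<le> a * L * exp (a * L)"
    by (simp add: exp_minus field_simps)
  also have "\<dots> \<le> a * L * exp (\<epsilon> / 2 * L)"
    using assms L mult_right_mono[OF assms(2) L] by (intro mult_left_mono) auto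
  also have "\<dots> = 2 * a / \<epsilon> * (\<epsilon> / 2 * L) * exp (\<epsilon> / 2 * L)" using assms by simp
  also have "\<dots> \<le> 2 * a / \<epsilon> * exp (\<epsilon> / 2 * L) * exp (\<epsilon> / 2 * L)"
  proof (intro mult_right_mono mult_left_mono)
    show "\<epsilon> / 2 * L \<le> exp (\<epsilon> / 2 * L)" using exp_ge_add_one_self[of "\<epsilon> / 2 * L"] by linarith
  qed (use assms in auto)
  also have "\<dots> = 2 * a / \<epsilon> * exp (\<epsilon> * L)" by (simp add: mult.assoc flip: exp_add)
  finally show ?thesis by (simp add: x)
qed

theorem theorem6:
  fixes \<alpha> c \<gamma> c\<^sub>q \<gamma>\<^sub>q \<zeta>\<^sub>0 M1 M2 cbar :: real
  assumes "0 < \<alpha>" "\<alpha> < 1 / 2"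
    and "c > 0" "0 \<le> \<gamma>" "\<gamma> < 1 / 2"
    and "c\<^sub>q > 0" "2 * \<gamma> < \<gamma>\<^sub>q" "\<gamma>\<^sub>q \<le> 1"
    and "0 < \<zeta>\<^sub>0" "\<zeta>\<^sub>0 < 1"
    and "M1 > 1" "M2 > 0" "cbar \<ge> 1"
  shows "\<exists>c\<^sub>1>0. \<forall>(n::nat) (p::nat) (k::nat) (k\<^sub>1::nat) (q::nat) (\<beta>::real vec) (\<sigma>::real) (\<xi>::real vec).
    n \<ge> 1 \<longrightarrow> p \<ge> 2 \<longrightarrow>
    real k \<le> c * min (real p powr \<gamma>) (real n / ln (real p)) \<longrightarrow>
    \<bar>real q - c\<^sub>q * real p powr \<gamma>\<^sub>q\<bar> < 1 \<longrightarrow>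
    real k\<^sub>1 \<le> (1 - \<zeta>\<^sub>0) * real k - 1 \<longrightarrow>
    (\<beta>, 1\<^sub>m p, \<sigma>) \<in> Theta p M1 M2 k\<^sub>1 \<longrightarrow>
    \<xi> \<in> Xi p q cbar \<longrightarrow>
    (INF CI\<in>conf_intervals n p \<alpha> (Theta p M1 M2 k) (\<lambda>b. scalar_prod \<xi> b).
        expected_length n p (\<beta>, 1\<^sub>m p, \<sigma>) CI)
      \<ge> ennreal (c\<^sub>1 * linf_norm \<xi> * real k * sqrt (ln (real p) / real n) * \<sigma>)"
proof -
  define \<eta> where "\<eta> = (1 - 2 * \<alpha>) / 2"
  define \<epsilon> where "\<epsilon> = \<gamma>\<^sub>q - 2 * \<gamma>"
  define C where "C = 4 * c\<^sup>2 / c\<^sub>q"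
  \<comment> \<open>The perturbation has size \<open>\<sigma> * sqrt (a / 2 * ln p / n)\<close>. The three bounds on \<open>a\<close> give, in this
    order, half of the variance at most for the perturbation, the hypothesis of \<open>powr_minus_one_le\<close>, and a second
    moment of at most \<open>1 + \<eta>\<^sup>2\<close>.\<close>
  define a where "a = Min {1 / c, \<epsilon> / 2, \<epsilon> * ln (1 + \<eta>\<^sup>2) / (2 * C)}"
  \<comment> \<open>The perturbation has about \<open>\<kappa> * k\<close> entries: at most \<open>k - k\<^sub>1\<close>, by \<open>\<zeta>\<^sub>0\<close>, and at most \<open>q\<close>, by the
    second term.\<close>
  define \<kappa> where "\<kappa> = min \<zeta>\<^sub>0 (c\<^sub>q / (2 * c))"
  have \<eta>: "\<eta> > 0" and \<epsilon>: "\<epsilon> > 0" and C: "C > 0" and \<kappa>: "0 < \<kappa>" "\<kappa> \<le> \<zeta>\<^sub>0" "\<kappa> \<le> c\<^sub>q / (2 * c)"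
    using assms by (auto simp: \<eta>_def \<epsilon>_def C_def \<kappa>_def)
  have "ln (1 + \<eta>\<^sup>2) > 0" using \<eta> by (intro ln_gt_zero) simp
  then have a: "a > 0" "a \<le> 1 / c" "a \<le> \<epsilon> / 2" "a \<le> \<epsilon> * ln (1 + \<eta>\<^sup>2) / (2 * C)"
    using assms \<epsilon> C by (auto simp: a_def)
  define c\<^sub>1 where "c\<^sub>1 = sqrt (a / 2) * \<kappa> / cbar * \<eta>"
  have c1: "c\<^sub>1 > 0" using a \<kappa> \<eta> assms by (simp add: c\<^sub>1_def)
  show ?thesis
  proof (intro exI[of _ c\<^sub>1] conjI allI impI c1 INF_greatest)
    fix n p k k\<^sub>1 q :: nat and \<beta> \<xi> :: "real Matrix.vec" and \<sigma> :: real and CI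
    assume n: "1 \<le> n" and p: "2 \<le> p"
      and k: "real k \<le> c * min (real p powr \<gamma>) (real n / ln (real p))"
      and q: "\<bar>real q - c\<^sub>q * real p powr \<gamma>\<^sub>q\<bar> < 1"
      and k1: "real k\<^sub>1 \<le> (1 - \<zeta>\<^sub>0) * real k - 1"
      and \<theta>: "(\<beta>, 1\<^sub>m p, \<sigma>) \<in> Theta p M1 M2 k\<^sub>1"
      and \<xi>: "\<xi> \<in> Xi p q cbar"
      and CI: "CI \<in> conf_intervals n p \<alpha> (Theta p M1 M2 k) (\<lambda>b. scalar_prod \<xi> b)"
    have lnp: "ln (real p) > 0" using p by simp
    have "c * min (real p powr \<gamma>) (real n / ln (real p)) \<le> c * real p powr \<gamma>"
      "c * min (real p powr \<gamma>) (real n / ln (real p)) \<le> c * (real n / ln (real p))"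
      using assms(3) by (intro mult_left_mono min.cobounded1 min.cobounded2; simp)+
    then have k_p: "real k \<le> c * real p powr \<gamma>" and k_n: "real k \<le> c * (real n / ln (real p))"
      using k by linarith+
    have "0 \<le> (1 - \<zeta>\<^sub>0) * real k - 1" using k1 of_nat_0_le_iff[of k\<^sub>1, where 'a = real] by linarith
    then have k_pos: "real k > 0"
      by (cases "k = 0") auto
    have \<xi>_carrier: "\<xi> \<in> carrier_vec p" and q_eq: "l0_norm \<xi> = q" using \<xi> by (auto simp: Xi_def)
    have q_pos: "q > 0"
    proof -
      have "\<xi> \<noteq> 0\<^sub>v p" using \<xi> by (simp add: Xi_def)
      then obtain j where "j \<in> supp \<xi>" using \<xi>_carrier by (auto simp: supp_def vec_eq_iff)
      moreover have "finite (supp \<xi>)" by (simp add: supp_def)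
      ultimately show ?thesis using q_eq by (auto simp: l0_norm_def card_gt_0_iff)
    qed
    \<comment> \<open>The rounding error in \<open>q\<close> is absorbed in a factor \<open>2\<close>, by \<open>q \<ge> 1\<close> if \<open>c\<^sub>q * p powr \<gamma>\<^sub>q\<close> is below \<open>2\<close>.\<close>
    have q_ge: "c\<^sub>q / 2 * real p powr \<gamma>\<^sub>q \<le> real q"
      using q q_pos by (cases "c\<^sub>q * real p powr \<gamma>\<^sub>q \<ge> 2") (auto simp: abs_less_iff)
    define s where "s = nat \<lceil>\<kappa> * real k\<rceil>"
    have s_ge: "\<kappa> * real k \<le> real s" and s_lt: "real s < \<kappa> * real k + 1"
    proof -
      have "0 \<le> \<kappa> * real k" using \<kappa> by simp
      then show "\<kappa> * real k \<le> real s" "real s < \<kappa> * real k + 1"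
        unfolding s_def by linarith+
    qed
    have s_pos: "0 < s" using s_ge mult_pos_pos[OF \<kappa>(1) k_pos] by (cases "s = 0") auto
    have "\<kappa> * real k \<le> \<zeta>\<^sub>0 * real k" using \<kappa> k_pos by (intro mult_right_mono) auto
    then have "real k\<^sub>1 + real s < real k" using s_lt k1 by (simp add: algebra_simps)
    then have k1_s: "k\<^sub>1 + s < k" by linarith
    then have s_k: "real s \<le> real k" by simp
    have s_q: "s \<le> q"
    proof -
      have "\<kappa> * real k \<le> c\<^sub>q / (2 * c) * (c * real p powr \<gamma>)"
        using \<kappa> k_p k_pos assms by (intro mult_mono) auto
      also have "\<dots> = c\<^sub>q / 2 * real p powr \<gamma>" using assms by simp
      also have "\<dots> \<le> c\<^sub>q / 2 * real p powr \<gamma>\<^sub>q"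
        using assms p by (intro mult_left_mono powr_mono) auto
      also have "\<dots> \<le> real q" by (rule q_ge)
      finally show ?thesis unfolding s_def by linarith
    qed
    define m where "m = q div s"
    have m_pos: "m > 0" using s_q s_pos by (simp add: m_def div_greater_zero_iff)
    have m_ge: "real q \<le> 2 * real m * real s"
    proof -
      have "q < m * s + s" unfolding m_def
        using s_pos by (metis add.commute dividend_less_div_times)
      also have "\<dots> \<le> m * s + m * s" using m_pos by simp
      finally have "q \<le> 2 * m * s" by simp
      then have "real q \<le> real (2 * m * s)" by (simp only: of_nat_le_iff)
      then show ?thesis by simp
    qed
    define r where "r = a / 2 * (ln (real p) / real n)"
    have r_nonneg: "0 \<le> r" using a lnp by (simp add: r_def)
    have s_r: "real s * r \<le> 1 / 2"
    proof -
      have "real s * r \<le> c * (real n / ln (real p)) * r"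
        using s_k k_n r_nonneg by (intro mult_right_mono) auto
      also have "\<dots> = c * a / 2" using lnp n by (simp add: r_def)
      also have "\<dots> \<le> 1 / 2" using a assms by (simp add: field_simps)
      finally show ?thesis .
    qed
    have exp_r: "exp (2 * real n * r) = real p powr a"
      using n p by (simp add: r_def powr_def)
    \<comment> \<open>The block size \<open>m\<close> is at least \<open>q / (2 * s)\<close>, so \<open>s / m\<close> is at most \<open>2 * s\<^sup>2 / q\<close>, which the dense loading
    regime turns into a negative power of \<open>p\<close>.\<close>
    have "real s * (real p powr a - 1) / real m \<le> ln (1 + \<eta>\<^sup>2)"
    proof -
      have pa: "0 \<le> real p powr a - 1" using p a by (simp add: ge_one_powr_ge_zero)
      have "real s / real m \<le> 2 * (real s)\<^sup>2 / real q"
        using m_ge m_pos q_pos s_pos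
        by (simp add: divide_simps power2_eq_square mult_ac)
      also have "\<dots> \<le> 2 * (c * real p powr \<gamma>)\<^sup>2 / (c\<^sub>q / 2 * real p powr \<gamma>\<^sub>q)"
        using q_ge q_pos s_k k_p assms p by (intro frac_le mult_left_mono power_mono) auto
      also have "\<dots> = C * real p powr (- \<epsilon>)"
        using assms p by (simp add: C_def \<epsilon>_def powr_minus powr_diff field_simps
            power2_eq_square flip: powr_add)
      finally have "real s / real m * (real p powr a - 1) \<le> C * real p powr (- \<epsilon>) * (real p powr a - 1)"
        using pa by (intro mult_right_mono)
      also have "\<dots> \<le> C * real p powr (- \<epsilon>) * (2 * a / \<epsilon> * real p powr \<epsilon>)"
        using C a p by (intro mult_left_mono powr_minus_one_le) auto
      also have "\<dots> = C * (2 * a / \<epsilon>)"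
        using p by (simp add: powr_minus)
      also have "\<dots> \<le> ln (1 + \<eta>\<^sup>2)" using a(4) C \<epsilon> by (simp add: field_simps)
      finally show ?thesis by simp
    qed
    then have chi: "exp (real s * (exp (2 * real n * r) - 1) / real (l0_norm \<xi> div s)) \<le> 1 + \<eta>\<^sup>2"
      unfolding exp_r q_eq m_def[symmetric] by (simp add: ln_ge_iff add_pos_nonneg)
    have dim: "dim_vec \<xi> > 0" using \<xi>_carrier p by auto
    have linf: "0 \<le> linf_norm \<xi>" using dim by (rule linf_norm_nonneg)
    have \<sigma>: "\<sigma> > 0" using \<theta> by (simp add: Theta_def)
    have \<theta>': "(\<beta>, 1\<^sub>m p, \<sigma>) \<in> Theta p M1 M2 k" and sparse: "l0_norm \<beta> + s \<le> k"
      using \<theta> k1_s by (auto simp: Theta_def)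
    have "ennreal (c\<^sub>1 * linf_norm \<xi> * real k * sqrt (ln (real p) / real n) * \<sigma>)
        \<le> ennreal (\<sigma> * sqrt r * real s * (linf_norm \<xi> / cbar) * (1 - 2 * \<alpha> - \<eta>))"
    proof (rule ennreal_leI)
      have "c\<^sub>1 * linf_norm \<xi> * real k * sqrt (ln (real p) / real n) * \<sigma>
          = \<sigma> * sqrt r * (\<kappa> * real k) * (linf_norm \<xi> / cbar) * \<eta>"
        unfolding r_def c\<^sub>1_def real_sqrt_mult by simp
      also have "\<dots> \<le> \<sigma> * sqrt r * real s * (linf_norm \<xi> / cbar) * \<eta>"
        using s_ge \<sigma> r_nonneg linf \<eta> assms by (intro mult_right_mono mult_left_mono) auto
      also have "\<eta> = 1 - 2 * \<alpha> - \<eta>" by (simp add: \<eta>_def field_simps)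
      finally show "c\<^sub>1 * linf_norm \<xi> * real k * sqrt (ln (real p) / real n) * \<sigma>
          \<le> \<sigma> * sqrt r * real s * (linf_norm \<xi> / cbar) * (1 - 2 * \<alpha> - \<eta>)" .
    qed
    also have "\<dots> \<le> expected_length n p (\<beta>, 1\<^sub>m p, \<sigma>) CI"
      using s_q q_eq linf assms linf_norm_le_of_Xi[OF \<xi>]
      by (intro expected_length_lower_bound[OF \<theta>' \<xi>_carrier sparse s_pos _ r_nonneg s_r \<eta> chi _ _ CI]) auto
    finally show "ennreal (c\<^sub>1 * linf_norm \<xi> * real k * sqrt (ln (real p) / real n) * \<sigma>)
        \<le> expected_length n p (\<beta>, 1\<^sub>m p, \<sigma>) CI" .
  qed
qed

end
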